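(* Let $p$ be a radial weight and let $V=\{(z_j,m_j)\}_{j\in\mathbb{N}}$ be a multiplicity variety. Assume that there exist constants $A,B>0$ such that for all $j\in\mathbb{N}$ $$N(z_j,e)\le A\,p(z_j)+B,$$ and that there exist constants $A',B'>0$ such that for all $r>0$ $$\int_0^r n(0,t)\,dt\le A'\,p(r)+B'.$$ Then $V$ is an interpolating variety for $A_p(\mathbb{C})$.
   Context: A weight is a subharmonic function $p:\mathbb{C}\to[0,\infty)$ such that (a) $\ln(1+|z|^2)=O(p(z))$ as $|z|\to\infty$; (b) there exist constants $C_1,C_2>0$ such that $|z-w|\le 1$ implies $p(w)\le C_1p(z)+C_2$. The weight is radial if $p(z)=p(|z|)$ for all $z$; then $p(r)$, $r\ge0$, denotes the common value of $p$ on $|z|=r$. $A_p(\mathbb{C})$ is the space of entire functions $f$ for which there exist $A,B>0$ with $|f(z)|\le Ae^{Bp(z)}$ for all $z\in\mathbb{C}$. A multiplicity variety $V=\{(z_j,m_j)\}_{j\in\mathbb{N}}$ consists of a sequence of (pairwise distinct) points $z_j\in\mathbb{C}$ with $|z_j|\to\infty$ and a sequence of positive integers $m_j$. $V$ is an interpolating variety for $A_p(\mathbb{C})$ if for every family $\{w_{j,l}\}_{j\in\mathbb{N},\,0\le l<m_j}$ of complex numbers for which there exist $A,B>0$ with $\sum_{l=0}^{m_j-1}|w_{j,l}|\le Ae^{Bp(z_j)}$ for all $j$, there is $f\in A_p(\mathbb{C})$ with $f^{(l)}(z_j)/l!=w_{j,l}$ for all $j\in\mathbb{N}$ and $0\le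 l<m_j$. For $z\in\mathbb{C}$ and $r>0$, $n(z,r)=\sum_{|z-z_j|\le r}m_j$ (and $n(z,0)$ is $m_j$ if $z=z_j$ for some $j$, and $0$ otherwise), and $$N(z,r)=\int_0^r\frac{n(z,t)-n(z,0)}{t}\,dt+n(z,0)\ln r=\sum_{0<|z-z_j|\le r}m_j\ln\frac{r}{|z-z_j|}+n(z,0)\ln r.$$ Here $e$ is the base of natural logarithms. *)

theory Defs
  imports "HOL-Complex_Analysis.Complex_Analysis" "HOL-Library.Landau_Symbols"
begin

text \<open>
  Subharmonicity on the whole plane, for functions that never take the value minus infinity: upper
  semicontinuity together with the sub-mean value inequality. For such functions the
  integrability clause is part of the inequality: the integrand is bounded above, so its Lebesgue
  integral always exists in the extended sense, and the inequality rules out the value minus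
  infinity. It is stated separately because \<open>integral\<close> is 0 for non-integrable functions.
\<close>

definition subharmonic :: "(complex \<Rightarrow> real) \<Rightarrow> bool" where
  "subharmonic u \<longleftrightarrow>
     (\<forall>c. open {z. u z < c}) \<and>
     (\<forall>z r. r > 0 \<longrightarrow>
        (\<lambda>t. u (z + of_real r * cis t)) absolutely_integrable_on {0..2 * pi} \<and>
        u z \<le> 1 / (2 * pi) * integral {0..2 * pi} (\<lambda>t. u (z + of_real r * cis t)))"

definition weight :: "(complex \<Rightarrow> real) \<Rightarrow> bool" where
  "weight p \<longleftrightarrow>
     subharmonic p \<and> (\<forall>z. p z \<ge> 0) \<and>
     (\<lambda>z. ln (1 + (cmod z)\<^sup>2)) \<in> O[at_infinity](p) \<and>
     (\<exists>C1>0. \<exists>C2>0. \<forall>z w. cmod (z - w) \<le> 1 \<longrightarrow> p w \<le> C1 * p z + C2)"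

definition radial :: "(complex \<Rightarrow> real) \<Rightarrow> bool" where
  "radial p \<longleftrightarrow> (\<forall>z. p z = p (of_real (cmod z)))"

definition A_space :: "(complex \<Rightarrow> real) \<Rightarrow> (complex \<Rightarrow> complex) set" where
  "A_space p = {f. f holomorphic_on UNIV \<and>
                   (\<exists>A>0. \<exists>B>0. \<forall>z. cmod (f z) \<le> A * exp (B * p z))}"

definition multiplicity_variety :: "(nat \<Rightarrow> complex) \<Rightarrow> (nat \<Rightarrow> nat) \<Rightarrow> bool" where
  "multiplicity_variety z m \<longleftrightarrow>
     inj z \<and> filterlim (\<lambda>j. cmod (z j)) at_top sequentially \<and> (\<forall>j. m j > 0)"

definition interpolating_variety ::
    "(complex \<Rightarrow> real) \<Rightarrow> (nat \<Rightarrow> complex) \<Rightarrow> (nat \<Rightarrow> nat) \<Rightarrow> bool" where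
  "interpolating_variety p z m \<longleftrightarrow>
     (\<forall>w :: nat \<Rightarrow> nat \<Rightarrow> complex.
        (\<exists>A>0. \<exists>B>0. \<forall>j. (\<Sum>l<m j. cmod (w j l)) \<le> A * exp (B * p (z j))) \<longrightarrow>
        (\<exists>f\<in>A_space p. \<forall>j. \<forall>l<m j. (deriv ^^ l) f (z j) / fact l = w j l))"

text \<open>
  For a multiplicity variety the index set below is finite, and at \<open>r = 0\<close> the sum is the
  multiplicity of \<open>a\<close> (0 if \<open>a\<close> is not one of the points).
\<close>

definition n_count :: "(nat \<Rightarrow> complex) \<Rightarrow> (nat \<Rightarrow> nat) \<Rightarrow> complex \<Rightarrow> real \<Rightarrow> nat" where
  "n_count z m a r = (\<Sum>j | cmod (a - z j) \<le> r. m j)"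

definition N_count :: "(nat \<Rightarrow> complex) \<Rightarrow> (nat \<Rightarrow> nat) \<Rightarrow> complex \<Rightarrow> real \<Rightarrow> real" where
  "N_count z m a r =
     integral {0..r} (\<lambda>t. (real (n_count z m a t) - real (n_count z m a 0)) / t)
       + real (n_count z m a 0) * ln r"

end

theory Submission
  imports Defs
begin

text \<open>
  Write \<open>P = p + 1\<close>, and let the data at the node \<open>z\<^sub>j\<close> be of size at most
  \<open>A exp (B P(z\<^sub>j))\<close>. They are interpolated by a sum of functions \<open>f\<^sub>j =
  h\<^sub>j g\<^sub>j G\<^sub>j\<close>: the factor \<open>h\<^sub>j\<close> vanishes to order
  \<open>m\<^sub>k\<close> at every other node \<open>z\<^sub>k\<close>, the factor \<open>G\<^sub>j\<close>
  adjusts the Taylor coefficients at \<open>z\<^sub>j\<close>, and \<open>g\<^sub>j\<close> is a peak at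
  \<open>z\<^sub>j\<close> which makes the sum converge.

  The factor of \<open>h\<^sub>j\<close> that belongs to \<open>a = z\<^sub>k\<close> is the
  \<open>m\<^sub>k\<close>-th power of \<open>1 - exp (\<mu> cnj u (z - a))\<close>, with \<open>u = a /
  |a|\<close> and \<open>\<mu> > 0\<close>. The exponential has modulus at most \<open>exp (\<mu> (|z| -
  |a|))\<close>. Hence \<open>ln |h\<^sub>j(z)|\<close> is at most a multiple of the sum of \<open>m\<^sub>k
  (|z| - |z\<^sub>k|)\<close> over the nodes with \<open>|z\<^sub>k| \<le> |z|\<close>, which is the integral of
  \<open>n(0,t)\<close> over \<open>[0,|z|]\<close> bounded in the second hypothesis, plus terms of order
  \<open>P(z)\<close>: \<open>P\<close> grows at most exponentially, and the part of the sum with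
  \<open>|z\<^sub>k| > |z|\<close> decays faster once \<open>\<mu>\<close> is large
  (\<open>product_upper\<close>). The other zeros of the function \<open>1 - exp (\<mu> cnj u (z - a))\<close>
  lie on the tangent at \<open>a\<close> to the circle about the origin, at mutual distance
  \<open>2\<pi>/\<mu>\<close>. So \<open>\<mu>\<close> may be chosen in a fixed interval, depending on
  \<open>j\<close> and \<open>k\<close>, to keep them away from \<open>z\<^sub>j\<close>. The modulus of this
  function is then at least a constant times \<open>min 1 |z\<^sub>j - z\<^sub>k|\<close> near
  \<open>z\<^sub>j\<close>, and the product of these lower bounds is controlled by \<open>N(z\<^sub>j,e)\<close>
  (\<open>product_lower\<close>).

  A radial subharmonic function is convex in \<open>ln |z|\<close>. If \<open>\<beta>\<close> is the slope of a
  supporting line at \<open>z\<^sub>j\<close>, where \<open>|z\<^sub>j| \<ge> 1\<close>, and \<open>N\<close> is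
  about \<open>D \<beta>\<close>, then \<open>(z / z\<^sub>j)^N\<close> equals 1 at \<open>z\<^sub>j\<close> and
  is at most \<open>exp (C P(z) - D P(z\<^sub>j))\<close> everywhere (\<open>peak_functions\<close>), with
  \<open>D\<close> at our disposal.

  By the first hypothesis no other node is closer to \<open>z\<^sub>j\<close> than \<open>exp (- C P(z\<^sub>j)
  / m\<^sub>j)\<close>. On a disc of that radius one divides the data polynomial by \<open>h\<^sub>j
  g\<^sub>j\<close> and truncates the expansion of the quotient in powers of \<open>1 - exp (cnj u (z -
  z\<^sub>j))\<close>; unlike powers of \<open>z - z\<^sub>j\<close>, these obey a bound of the same kind as
  \<open>h\<^sub>j\<close>. The coefficients are of order \<open>radius^(- m\<^sub>j)\<close>, that is
  \<open>exp (C P(z\<^sub>j))\<close>. To make the lower bound for \<open>g\<^sub>j\<close> independent of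
  \<open>D\<close>, the radius has to shrink like \<open>1 / D\<close>; as \<open>m\<^sub>j\<close> is at most
  of order \<open>P(z\<^sub>j)\<close>, this only costs a factor \<open>exp (C P(z\<^sub>j) ln D)\<close>. For
  large \<open>D\<close> the gain \<open>exp (- D P(z\<^sub>j))\<close> of the peak wins
  (\<open>node_functions\<close>), and the remaining powers of \<open>exp (- P(z\<^sub>j))\<close> are summable
  because a disc of radius \<open>r\<close> contains \<open>O(P(r))\<close> nodes.

  All this is done for finitely many nodes, with bounds independent of their number; Montel's theorem then gives
  the function for all nodes (\<open>interpolation\<close>).
\<close>

section \<open>Taylor jets of holomorphic functions\<close>

lemma higher_deriv_sum:
  assumes "finite A" "\<And>i. i \<in> A \<Longrightarrow> f i holomorphic_on S" "open S" "x \<in> S"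
  shows "(deriv ^^ n) (\<lambda>w. \<Sum>i\<in>A. f i w) x = (\<Sum>i\<in>A. (deriv ^^ n) (f i) x)"
  using assms(1,2)
proof (induction A rule: finite_induct)
  case empty
  then show ?case by simp
next
  case (insert i A)
  have "(deriv ^^ n) (\<lambda>w. f i w + (\<Sum>i\<in>A. f i w)) x
      = (deriv ^^ n) (f i) x + (deriv ^^ n) (\<lambda>w. \<Sum>i\<in>A. f i w) x"
    using insert by (intro higher_deriv_add[OF _ _ assms(3,4)] holomorphic_intros) auto
  then show ?case using insert by simp
qed

lemma higher_deriv_centered_power:
  "(deriv ^^ l) (\<lambda>w::complex. (w - a) ^ n) a = (if l = n then fact n else 0)"
proof -
  have "(deriv ^^ l) (\<lambda>w. (w - a) ^ n) a = pochhammer (of_nat (Suc n - l)) l * (a - a) ^ (n - l)"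
    by (rule higher_deriv_power)
  moreover have "pochhammer (of_nat (Suc n - l)) l = (0::complex)" if "l > n"
    using that by (simp add: pochhammer_0_left)
  ultimately show ?thesis
    by (cases l n rule: linorder_cases) (auto simp: pochhammer_fact)
qed

lemma higher_deriv_taylor_polynomial:
  "(deriv ^^ l) (\<lambda>x::complex. \<Sum>i<n. w i * (x - a) ^ i) a = (if l < n then fact l * w l else 0)"
proof -
  have "(deriv ^^ l) (\<lambda>x. \<Sum>i<n. w i * (x - a) ^ i) a
      = (\<Sum>i<n. (deriv ^^ l) (\<lambda>x. w i * (x - a) ^ i) a)"
    by (rule higher_deriv_sum[of _ _ UNIV]) (auto intro!: holomorphic_intros)
  also have "\<dots> = (\<Sum>i<n. w i * (deriv ^^ l) (\<lambda>x. (x - a) ^ i) a)"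
    by (intro sum.cong refl higher_deriv_cmult[of _ UNIV]) (auto intro!: holomorphic_intros)
  also have "\<dots> = (\<Sum>i<n. if i = l then w l * fact l else 0)"
    by (intro sum.cong) (auto simp: higher_deriv_centered_power)
  finally show ?thesis by (simp add: mult.commute)
qed

lemma higher_deriv_eq_0_if_factor:
  assumes "q holomorphic_on S" "open S" "a \<in> S" "l < n"
  shows "(deriv ^^ l) (\<lambda>x. (x - a) ^ n * q x) a = 0"
proof -
  have "(deriv ^^ l) (\<lambda>x. (x - a) ^ n * q x) a = (\<Sum>i = 0..l. of_nat (l choose i) *
      (deriv ^^ i) (\<lambda>x. (x - a) ^ n) a * (deriv ^^ (l - i)) q a)"
    by (intro higher_deriv_mult[OF _ assms(1-3)] holomorphic_intros)
  also have "\<dots> = 0"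
    using assms(4) by (intro sum.neutral) (auto simp: higher_deriv_centered_power)
  finally show ?thesis .
qed

lemma higher_deriv_eq_if_diff_factor:
  assumes "f holomorphic_on S" "g holomorphic_on S" "q holomorphic_on S" "open S" "a \<in> S" "l < n"
    and eq: "\<And>x. x \<in> S \<Longrightarrow> f x - g x = (x - a) ^ n * q x"
  shows "(deriv ^^ l) f a = (deriv ^^ l) g a"
proof -
  have "(deriv ^^ l) f a - (deriv ^^ l) g a = (deriv ^^ l) (\<lambda>x. f x - g x) a"
    using assms by (intro higher_deriv_diff[symmetric])
  also have "\<dots> = (deriv ^^ l) (\<lambda>x. (x - a) ^ n * q x) a"
    using assms by (intro higher_deriv_transform_within_open[of _ S] holomorphic_intros eq) auto
  also have "\<dots> = 0"
    using assms by (intro higher_deriv_eq_0_if_factor[of q S])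
  finally show ?thesis by simp
qed

lemma holomorphic_factor_simple:
  assumes "f holomorphic_on S" "open S"
  obtains q where "q holomorphic_on S" "\<And>x. f x - f a = (x - a) * q x" "q a = deriv f a"
proof
  show "(\<lambda>z. if z = a then deriv f a else (f z - f a)/(z-a)) holomorphic_on S"
    by (rule pole_lemma_open[OF assms])
qed auto

text \<open>
  A Taylor expansion in powers of a local coordinate \<open>\<omega>\<close> in place of \<open>x - a\<close>. Splitting off one term
  replaces the remainder \<open>r\<close> by \<open>(r - r a) / \<omega>\<close>, and by the maximum principle on the disc of radius
  \<open>d\<close> this enlarges its bound by the factor \<open>2 / \<kappa>\<close> at most. The bound for the remainder is there for the induction.
\<close>

lemma expansion_in_local_coordinate:
  fixes g \<omega> :: "complex \<Rightarrow> complex"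
  assumes \<omega>: "\<omega> holomorphic_on ball a R" "\<omega> a = 0" "deriv \<omega> a \<noteq> 0"
      "\<And>x. x \<in> ball a R \<Longrightarrow> x \<noteq> a \<Longrightarrow> \<omega> x \<noteq> 0"
    and d: "0 < d" "d < R" and kap: "0 < \<kappa>" "\<And>x. cmod (x - a) = d \<Longrightarrow> \<kappa> \<le> cmod (\<omega> x)"
    and g: "g holomorphic_on ball a R" "\<And>x. cmod (x - a) \<le> d \<Longrightarrow> cmod (g x) \<le> M"
  shows "\<exists>c r. r holomorphic_on ball a R \<and>
      (\<forall>x\<in>ball a R. g x = (\<Sum>l<n. c l * \<omega> x ^ l) + \<omega> x ^ n * r x) \<and>
      (\<forall>l<n. cmod (c l) \<le> M * (2 / \<kappa>) ^ l) \<and>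
      (\<forall>x. cmod (x - a) \<le> d \<longrightarrow> cmod (r x) \<le> M * (2 / \<kappa>) ^ n)"
proof (induction n)
  case 0
  show ?case by (rule exI[of _ "\<lambda>_. 0"], rule exI[of _ g]) (simp add: g)
next
  case (Suc n)
  from Suc.IH obtain c r where IH: "r holomorphic_on ball a R \<and>
      (\<forall>x\<in>ball a R. g x = (\<Sum>l<n. c l * \<omega> x ^ l) + \<omega> x ^ n * r x) \<and>
      (\<forall>l<n. cmod (c l) \<le> M * (2 / \<kappa>) ^ l) \<and>
      (\<forall>x. cmod (x - a) \<le> d \<longrightarrow> cmod (r x) \<le> M * (2 / \<kappa>) ^ n)"
    by (elim exE) (rule that)
  then have r: "r holomorphic_on ball a R"
      "\<And>x. x \<in> ball a R \<Longrightarrow> g x = (\<Sum>l<n. c l * \<omega> x ^ l) + \<omega> x ^ n * r x"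
      "\<And>l. l < n \<Longrightarrow> cmod (c l) \<le> M * (2 / \<kappa>) ^ l"
      "\<And>x. cmod (x - a) \<le> d \<Longrightarrow> cmod (r x) \<le> M * (2 / \<kappa>) ^ n" by auto
  obtain q where q: "q holomorphic_on ball a R" "\<And>x. r x - r a = (x - a) * q x"
    using holomorphic_factor_simple[OF r(1) open_ball] by metis
  obtain v where v: "v holomorphic_on ball a R" "\<And>x. \<omega> x - \<omega> a = (x - a) * v x" "v a = deriv \<omega> a"
    using holomorphic_factor_simple[OF \<omega>(1) open_ball] by metis
  have v0: "v x \<noteq> 0" if "x \<in> ball a R" for x
    using \<omega>(4)[OF that] v(2)[of x] v(3) \<omega>(2,3) by (cases "x = a") auto
  define s where "s x = q x / v x" for x
  have s: "s holomorphic_on ball a R"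
    unfolding s_def using v0 q(1) v(1) by (intro holomorphic_intros) auto
  have rs: "r x = r a + \<omega> x * s x" if "x \<in> ball a R" for x
  proof -
    have "\<omega> x = (x - a) * v x" using v(2)[of x] \<omega>(2) by simp
    then have "\<omega> x * s x = (x - a) * q x" using v0[OF that] by (simp add: s_def)
    then have "r x - r a = \<omega> x * s x" using q(2)[of x] by simp
    then show ?thesis by (simp add: diff_eq_eq add.commute)
  qed
  have bd: "cmod (s x) \<le> M * (2 / \<kappa>) ^ Suc n" if "cmod (x - a) \<le> d" for x
  proof (rule maximum_modulus_frontier[of s "cball a d"])
    show "s holomorphic_on interior (cball a d)"
      using d by (intro holomorphic_on_subset[OF s]) auto
    show "continuous_on (closure (cball a d)) s"
      using d by (intro holomorphic_on_imp_continuous_on holomorphic_on_subset[OF s]) auto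
    show "bounded (cball a d)" by simp
    show "x \<in> cball a d" using that by (simp add: dist_norm norm_minus_commute)
    fix y assume "y \<in> frontier (cball a d)"
    then have y: "cmod (y - a) = d" by (simp add: dist_norm norm_minus_commute)
    then have yb: "y \<in> ball a R" using d by (simp add: dist_norm norm_minus_commute)
    have "\<kappa> * cmod (s y) \<le> cmod (\<omega> y) * cmod (s y)"
      using kap(2)[OF y] by (intro mult_right_mono) auto
    also have "\<dots> = cmod (r y - r a)" using rs[OF yb] by (simp add: norm_mult)
    also have "\<dots> \<le> cmod (r y) + cmod (r a)" by (rule norm_triangle_ineq4)
    also have "\<dots> \<le> 2 * (M * (2 / \<kappa>) ^ n)" using r(4)[of y] r(4)[of a] y d by simp
    finally show "cmod (s y) \<le> M * (2 / \<kappa>) ^ Suc n" using kap(1) by (simp add: field_simps)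
  qed
  have eq: "g x = (\<Sum>l<Suc n. (c(n := r a)) l * \<omega> x ^ l) + \<omega> x ^ Suc n * s x"
    if "x \<in> ball a R" for x
    using r(2)[OF that] rs[OF that] by (simp add: algebra_simps)
  have cb: "cmod ((c(n := r a)) l) \<le> M * (2 / \<kappa>) ^ l" if "l < Suc n" for l
    using that r(3)[of l] r(4)[of a] d by (auto simp: less_Suc_eq)
  show ?case
    using s eq cb bd by blast
qed

section \<open>Lower bounds for one minus an exponential\<close>

lemma sin_ge_half: 
  fixes x :: real assumes "0 \<le> x" "x \<le> 1" shows "x / 2 \<le> sin x"
proof -
  define g where "g = (\<lambda>t::real. sin t - t / 2)"
  have "g 0 \<le> g x"
  proof (rule DERIV_nonneg_imp_nondecreasing[OF assms(1)])
    fix t :: real assume t: "0 \<le> t" "t \<le> x"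
    have "cos (pi / 3) \<le> cos t" using t assms pi_gt3 by (intro cos_monotone_0_pi_le) auto
    then have "0 \<le> cos t - 1 / 2" by (simp add: cos_60)
    moreover have "DERIV g t :> cos t - 1 / 2"
      unfolding g_def by (auto intro!: derivative_eq_intros)
    ultimately show "\<exists>y. DERIV g t :> y \<and> 0 \<le> y" by blast
  qed
  then show ?thesis by (simp add: g_def)
qed

lemma norm_one_minus_exp_sq:
  "(cmod (1 - exp x))\<^sup>2 = (1 - exp (Re x))\<^sup>2 + 4 * exp (Re x) * (sin (Im x / 2))\<^sup>2"
proof -
  have "cos (Im x) = 1 - 2 * (sin (Im x / 2))\<^sup>2"
    using cos_double_sin[of "Im x / 2"] by simp
  moreover have "(cmod (1 - exp x))\<^sup>2 = (1 - exp (Re x) * cos (Im x))\<^sup>2 + (exp (Re x) * sin (Im x))\<^sup>2"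
    by (simp add: cmod_power2 Re_exp Im_exp)
  moreover have "\<dots> = 1 - 2 * (exp (Re x) * cos (Im x)) + (exp (Re x))\<^sup>2"
  proof -
    have "(exp (Re x))\<^sup>2 = (exp (Re x))\<^sup>2 * ((cos (Im x))\<^sup>2 + (sin (Im x))\<^sup>2)" by simp
    then show ?thesis by (simp only: power2_eq_square algebra_simps)
  qed
  moreover have "(1 - exp (Re x))\<^sup>2 = 1 - 2 * exp (Re x) + (exp (Re x))\<^sup>2"
    by (simp only: power2_eq_square algebra_simps)
  moreover have "exp (Re x) * cos (Im x) = exp (Re x) - 2 * exp (Re x) * (sin (Im x / 2))\<^sup>2"
    by (simp only: \<open>cos (Im x) = _\<close> algebra_simps)
  ultimately show ?thesis by linarith
qed

lemma one_minus_exp_ge_half: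
  fixes x :: real assumes "\<bar>x\<bar> \<le> 1" shows "\<bar>x\<bar> / 2 \<le> \<bar>1 - exp x\<bar>"
proof (cases "x \<ge> 0")
  case True then show ?thesis using exp_ge_add_one_self[of x] by linarith
next
  case False
  define y where "y = - x"
  have y: "0 < y" "y \<le> 1" using False assms by (auto simp: y_def)
  have "exp (- y) \<le> inverse (1 + y)"
    unfolding exp_minus using y exp_ge_add_one_self[of y] by (intro le_imp_inverse_le) auto
  moreover have "1 - inverse (1 + y) = y / (1 + y)" using y by (simp add: field_simps)
  moreover have "y / 2 \<le> y / (1 + y)" using y by (intro divide_left_mono) auto
  ultimately show ?thesis using y by (simp add: y_def)
qed

text \<open>
  Where \<open>\<bar>Re x\<bar> > 1\<close> already the moduli of \<open>1\<close> and \<open>exp x\<close> differ; elsewhere both squares in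
  \<open>norm_one_minus_exp_sq\<close> are at least fixed multiples of the squares of the coordinates of \<open>x\<close>.
\<close>

lemma norm_one_minus_exp_lower_near_0:
  assumes "\<bar>Im x\<bar> \<le> 2"
  shows "min 1 (cmod x) / 8 \<le> cmod (1 - exp x)"
proof (cases "\<bar>Re x\<bar> \<le> 1")
  case False
  have "1/8 \<le> \<bar>1 - exp (Re x)\<bar>"
  proof (cases "Re x > 1")
    case True then show ?thesis using exp_ge_add_one_self[of "Re x"] by linarith
  next
    case F: False
    then have "exp (Re x) \<le> exp (-1)" using False by auto
    moreover have "\<bar>-1\<bar> / 2 \<le> \<bar>1 - exp (-1::real)\<bar>" by (rule one_minus_exp_ge_half) auto
    moreover have "exp (-1::real) < 1" by simp
    ultimately show ?thesis by linarith
  qed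
  also have "\<dots> \<le> cmod (1 - exp x)"
    using norm_triangle_ineq3[of 1 "exp x"] by simp
  finally show ?thesis by linarith
next
  case True
  have re: "(Re x)\<^sup>2 / 4 \<le> (1 - exp (Re x))\<^sup>2"
    using power_mono[OF one_minus_exp_ge_half[OF True], of 2] by (simp add: power_divide)
  have "\<bar>Im x\<bar> / 2 / 2 \<le> sin (\<bar>Im x\<bar> / 2)" using assms by (intro sin_ge_half) auto
  also have "\<dots> \<le> \<bar>sin (Im x / 2)\<bar>"
    by (cases "Im x \<ge> 0") auto
  finally have "(\<bar>Im x\<bar> / 2 / 2)\<^sup>2 \<le> \<bar>sin (Im x / 2)\<bar>\<^sup>2" by (intro power_mono) auto
  then have im1: "(Im x)\<^sup>2 / 16 \<le> (sin (Im x / 2))\<^sup>2" by (simp add: power_divide)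
  have "exp (-1) \<le> exp (Re x)" using True by auto
  moreover have "exp (-1::real) \<ge> 1/16"
    using exp_le by (simp add: exp_minus field_simps)
  ultimately have "1/16 * ((Im x)\<^sup>2 / 16) \<le> exp (Re x) * (sin (Im x / 2))\<^sup>2"
    using im1 by (intro mult_mono) (auto intro: order_trans)
  then have "(Im x)\<^sup>2 / 64 \<le> 4 * exp (Re x) * (sin (Im x / 2))\<^sup>2" by simp
  with re have "((Re x)\<^sup>2 + (Im x)\<^sup>2) / 64 \<le> (cmod (1 - exp x))\<^sup>2"
    unfolding norm_one_minus_exp_sq add_divide_distrib
    using zero_le_power2[of "1 - exp (Re x)"] by linarith
  then have "(cmod x / 8)\<^sup>2 \<le> (cmod (1 - exp x))\<^sup>2"
    by (simp add: cmod_power2 power_divide)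
  then have "cmod x / 8 \<le> cmod (1 - exp x)" by (rule power2_le_imp_le) auto
  then show ?thesis by linarith
qed

text \<open>
  The first assumption says that \<open>exp x0\<close> is negative, so \<open>exp x\<close> is a negative number times
  \<open>exp (x - x0)\<close>, whose real part is not negative.
\<close>

lemma norm_one_minus_exp_lower_far:
  assumes "exp (\<i> * of_real (Im x0)) = -1" "cmod (x - x0) \<le> 1"
  shows "1 \<le> cmod (1 - exp x)"
proof -
  define d where "d = x - x0"
  have "exp x0 = of_real (exp (Re x0)) * exp (\<i> * of_real (Im x0))"
    by (metis complex_eq exp_add exp_of_real)
  then have "exp x = - of_real (exp (Re x0)) * exp d"
    unfolding d_def assms(1) exp_diff by simp
  then have "Re (1 - exp x) = 1 + exp (Re x0) * (exp (Re d) * cos (Im d))"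
    by (simp add: Re_exp)
  moreover have "cos (Im d) \<ge> 0"
  proof (rule cos_ge_zero)
    have "\<bar>Im d\<bar> \<le> 1" using abs_Im_le_cmod[of d] assms(2) by (simp add: d_def)
    then show "- (pi / 2) \<le> Im d" "Im d \<le> pi / 2" using pi_gt3 by auto
  qed
  ultimately have "1 \<le> Re (1 - exp x)" by simp
  also have "\<dots> \<le> cmod (1 - exp x)" by (rule complex_Re_le_cmod)
  finally show ?thesis .
qed

text \<open>
  The zeros of \<open>1 - exp (\<nu> x)\<close> other than the origin move with \<open>\<nu>\<close>. If \<open>x0\<close> is far from the real
  axis, choose \<open>\<nu>\<close> so that \<open>exp (\<nu> x0)\<close> is negative; then the imaginary part of \<open>\<nu> x0\<close> is halfway between
  those of two neighbouring zeros of \<open>1 - exp\<close>.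
\<close>

lemma dilation_avoiding_zeros:
  obtains \<nu> :: real where "1 \<le> \<nu>" "\<nu> \<le> 13"
    "\<And>x. cmod (x - x0) \<le> 1/13 \<Longrightarrow> min 1 (cmod x) / 8 \<le> cmod (1 - exp (of_real \<nu> * x))"
proof (cases "\<bar>Im x0\<bar> \<le> 1")
  case True
  have "min 1 (cmod x) / 8 \<le> cmod (1 - exp (of_real 1 * x))" if "cmod (x - x0) \<le> 1/13" for x
    using norm_one_minus_exp_lower_near_0[of x] abs_Im_le_cmod[of "x - x0"] that True by simp
  then show ?thesis by (intro that[of 1]) auto
next
  case False
  define y where "y = \<bar>Im x0\<bar>"
  define k where "k = real_of_int \<lceil>y / (2 * pi)\<rceil>"
  define \<nu> where "\<nu> = (2 * pi * k + pi) / y"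
  have y: "y > 1" using False by (simp add: y_def)
  have k: "y / (2 * pi) \<le> k" "k \<le> y / (2 * pi) + 1" unfolding k_def by linarith+
  have k1: "y \<le> 2 * pi * k" using k(1) by (simp add: divide_le_eq mult.commute)
  have "2 * pi * k \<le> 2 * pi * (y / (2 * pi) + 1)" using k(2) by (intro mult_left_mono) auto
  also have "\<dots> = y + 2 * pi" by (simp add: distrib_left)
  finally have k2: "2 * pi * k \<le> y + 2 * pi" .
  have nu: "1 \<le> \<nu>" unfolding \<nu>_def using y k1 pi_gt_zero
    by (simp only: le_divide_eq split: if_splits) linarith
  have "2 * pi * k + pi \<le> 13 * y" using k2 y pi_less_4 by linarith
  then have nu2: "\<nu> \<le> 13" unfolding \<nu>_def using y by (simp add: pos_divide_le_eq)
  have nuy: "\<nu> * y = 2 * pi * k + pi" unfolding \<nu>_def using y by simp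
  have c: "cos (\<nu> * Im x0) = -1 \<and> sin (\<nu> * Im x0) = 0"
  proof -
    have "cos (\<nu> * y) = -1 \<and> sin (\<nu> * y) = 0" unfolding nuy k_def
      by (simp only: cos_periodic_pi sin_periodic_pi cos_int_2pin sin_int_2pin) auto
    then show ?thesis unfolding y_def by (cases "Im x0 \<ge> 0") auto
  qed
  then have e: "exp (\<i> * of_real (Im (of_real \<nu> * x0))) = -1"
    by (simp add: complex_eq_iff Re_exp Im_exp)
  have "min 1 (cmod x) / 8 \<le> cmod (1 - exp (of_real \<nu> * x))" if "cmod (x - x0) \<le> 1/13" for x
  proof -
    have "cmod (of_real \<nu> * x - of_real \<nu> * x0) = \<nu> * cmod (x - x0)"
      using nu by (simp add: norm_mult flip: right_diff_distrib)
    also have "\<dots> \<le> 13 * (1/13)" using nu nu2 that by (intro mult_mono) auto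
    finally have "cmod (of_real \<nu> * x - of_real \<nu> * x0) \<le> 1" by simp
    from norm_one_minus_exp_lower_far[OF e this] show ?thesis by linarith
  qed
  then show ?thesis by (rule that[OF nu nu2])
qed

section \<open>Radial subharmonic functions\<close>

lemma holomorphic_circle_mean:
  fixes f :: "complex \<Rightarrow> complex"
  assumes "f holomorphic_on ball a R" "0 < r" "r < R"
  shows "((\<lambda>t. f (a + of_real r * cis t)) has_integral (2 * pi * f a)) {0..2 * pi}"
proof -
  have "((\<lambda>u. f u / (u - a)) has_contour_integral (2 * of_real pi * \<i> * f a)) (circlepath a r)"
    using assms by (intro Cauchy_integral_circlepath_simple holomorphic_on_subset[OF assms(1)]) auto
  then have "((\<lambda>t. f (a + r * cis t) / (a + r * cis t - a) * r * \<i> * cis t)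
      has_integral (2 * of_real pi * \<i> * f a)) {0..2 * pi}"
    unfolding circlepath_def by (subst (asm) has_contour_integral_part_circlepath_iff) auto
  moreover have "f (a + r * cis t) / (a + r * cis t - a) * r * \<i> * cis t = \<i> * f (a + r * cis t)" for t
    using assms by simp
  ultimately have "((\<lambda>t. \<i> * f (a + r * cis t)) has_integral (2 * of_real pi * \<i> * f a)) {0..2 * pi}"
    by (simp only:)
  from has_integral_mult_right[OF this, of "-\<i>"]
  have "((\<lambda>t. f (a + r * cis t)) has_integral (- \<i> * (2 * of_real pi * \<i> * f a))) {0..2 * pi}"
    by (simp flip: mult.assoc)
  also have "- \<i> * (2 * of_real pi * \<i> * f a) = 2 * pi * f a"
    by (simp add: algebra_simps)
  finally show ?thesis .
qed

text \<open>
  Otherwise the sets where \<open>u\<close> is below one of its own values cover \<open>K\<close>; for a finite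
  subcover, the point with the largest of these values is not covered.
\<close>

lemma upper_semicontinuous_attains_max:
  fixes u :: "'a::topological_space \<Rightarrow> 'b::linorder"
  assumes "compact K" "x0 \<in> K"
    and usc: "\<And>x c. x \<in> K \<Longrightarrow> u x < c \<Longrightarrow> \<exists>U. open U \<and> x \<in> U \<and> (\<forall>y\<in>U \<inter> K. u y < c)"
  obtains a where "a \<in> K" "\<And>y. y \<in> K \<Longrightarrow> u y \<le> u a"
proof (rule ccontr)
  assume "\<not> thesis"
  with that have "\<exists>y\<in>K. u x < u y" if "x \<in> K" for x using \<open>x \<in> K\<close> by (meson not_le)
  then have "\<forall>x\<in>K. \<exists>y. y \<in> K \<and> u x < u y" by blast
  from bchoice[OF this] obtain Y where Y: "\<forall>x\<in>K. Y x \<in> K \<and> u x < u (Y x)" ..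
  then have "\<forall>x\<in>K. \<exists>U. open U \<and> x \<in> U \<and> (\<forall>w\<in>U \<inter> K. u w < u (Y x))"
    using usc by blast
  from bchoice[OF this] obtain U
    where U: "\<forall>x\<in>K. open (U x) \<and> x \<in> U x \<and> (\<forall>w\<in>U x \<inter> K. u w < u (Y x))" ..
  obtain F where F: "F \<subseteq> K" "finite F" "K \<subseteq> (\<Union>x\<in>F. U x)"
    using compactE_image[OF assms(1), of K U] U by blast
  then have "F \<noteq> {}" using assms(2) by auto
  then have "Max ((u \<circ> Y) ` F) \<in> (u \<circ> Y) ` F" using F(2) by (intro Max_in) auto
  then obtain x where x: "x \<in> F" "Max ((u \<circ> Y) ` F) = u (Y x)" by auto
  obtain x' where x': "x' \<in> F" "Y x \<in> U x'" using F Y x(1) by blast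
  then have "u (Y x) < u (Y x')" using Y U F(1) x(1) x'(1) by blast
  moreover have "u (Y x') \<le> Max ((u \<circ> Y) ` F)" using F(2) x'(1) by (intro Max_ge) auto
  ultimately show False using x(2) by simp
qed

text \<open>
  This is the maximum principle for \<open>p - h\<close>. Adding the strictly subharmonic term \<open>\<epsilon> |z|\<^sup>2\<close>, with \<open>\<epsilon>\<close> too small to
  matter on the boundary, makes the mean over a small circle exceed the value at the centre by
  at least \<open>\<epsilon> r\<^sup>2\<close>, so an interior maximum is contradictory without any discussion of the case of equality.
\<close>

lemma subharmonic_le_harmonic_majorant:
  assumes sub: "subharmonic p" and K: "compact K" and h: "continuous_on K h"
    and harm: "\<And>a. a \<in> interior K \<Longrightarrow> \<exists>R>0. \<exists>f. f holomorphic_on ball a R \<and> (\<forall>x\<in>ball a R. h x = Re (f x))"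
    and bd: "\<And>x. x \<in> K - interior K \<Longrightarrow> p x \<le> h x"
    and x0: "x0 \<in> K"
  shows "p x0 \<le> h x0"
proof (rule ccontr)
  assume "\<not> p x0 \<le> h x0"
  then have pos: "p x0 - h x0 > 0" by simp
  obtain B where B: "B > 0" "\<And>x. x \<in> K \<Longrightarrow> cmod x \<le> B"
    using compact_imp_bounded[OF K] bounded_pos by metis
  define \<epsilon> where "\<epsilon> = (p x0 - h x0) / (2 * B\<^sup>2)"
  have eps: "\<epsilon> > 0" "\<epsilon> * B\<^sup>2 < p x0 - h x0" using pos B by (auto simp: \<epsilon>_def)
  define k where "k x = \<epsilon> * (cmod x)\<^sup>2 - h x" for x
  define v where "v x = p x + k x" for x
  have k: "continuous_on K k" unfolding k_def using h by (intro continuous_intros)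
  obtain a where a: "a \<in> K" "\<And>y. y \<in> K \<Longrightarrow> v y \<le> v a"
  proof (rule upper_semicontinuous_attains_max[OF K x0, of v])
    fix x c assume x: "x \<in> K" "v x < c"
    define d where "d = (c - v x) / 2"
    have d: "d > 0" using x by (simp add: d_def)
    have "open {z. p z < p x + d}" using sub by (simp add: subharmonic_def)
    moreover have "\<forall>\<^sub>F y in at x within K. k y < k x + d"
      using k x(1) d by (intro order_tendstoD) (auto simp: continuous_on_def)
    then obtain U where "open U" "x \<in> U" "\<And>y. y \<in> U \<Longrightarrow> y \<noteq> x \<Longrightarrow> y \<in> K \<Longrightarrow> k y < k x + d"
      unfolding eventually_at_topological by auto
    ultimately show "\<exists>U. open U \<and> x \<in> U \<and> (\<forall>y\<in>U \<inter> K. v y < c)"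
      using d by (intro exI[of _ "{z. p z < p x + d} \<inter> U"])
        (force simp: v_def d_def field_simps)
  qed (use that in auto)
  have vb: "v a > \<epsilon> * B\<^sup>2"
    using a(2)[OF x0] eps by (auto simp: v_def k_def intro: less_le_trans[of _ "p x0 - h x0"])
      (smt (verit) mult_nonneg_nonneg zero_le_power2)
  have "a \<in> interior K"
  proof (rule ccontr)
    assume "a \<notin> interior K"
    then have "v a \<le> \<epsilon> * (cmod a)\<^sup>2" using bd[of a] a(1) by (auto simp: v_def k_def)
    also have "\<dots> \<le> \<epsilon> * B\<^sup>2" using eps B(2)[OF a(1)] by (intro mult_left_mono power_mono) auto
    finally show False using vb by simp
  qed
  then obtain R f where f: "R > 0" "f holomorphic_on ball a R" "\<And>x. x \<in> ball a R \<Longrightarrow> h x = Re (f x)"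
    using harm by metis
  obtain e where e: "e > 0" "ball a e \<subseteq> K" using \<open>a \<in> interior K\<close> by (auto simp: mem_interior)
  define r where "r = min e R / 2"
  have r: "r > 0" "r < R" "r < e" using f(1) e(1) by (auto simp: r_def)
  \<comment> \<open>On the circle of radius \<open>r\<close> about \<open>a\<close> the bound \<open>v \<le> v a\<close> says \<open>p \<le> Re G\<close>.\<close>
  define G where "G x = of_real (v a) + f x - of_real \<epsilon> * (of_real ((cmod a)\<^sup>2 + r\<^sup>2) + 2 * cnj a * (x - a))" for x
  have "G holomorphic_on ball a R" unfolding G_def using f(2) by (intro holomorphic_intros)
  from has_integral_Re[OF holomorphic_circle_mean[OF this r(1,2)]]
  have int: "((\<lambda>t. Re (G (a + of_real r * cis t))) has_integral (2 * pi * Re (G a))) {0..2 * pi}"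
    by simp
  have le: "p (a + of_real r * cis t) \<le> Re (G (a + of_real r * cis t))" for t
  proof -
    let ?y = "a + of_real r * cis t"
    have "dist a ?y = r" using r(1) by (simp add: dist_norm norm_mult)
    then have y: "?y \<in> ball a R" "?y \<in> K" using r e by auto
    have "(cmod ?y)\<^sup>2 = (Re a + r * cos t)\<^sup>2 + (Im a + r * sin t)\<^sup>2"
      by (simp add: cmod_power2)
    also have "\<dots> = (Re a)\<^sup>2 + (Im a)\<^sup>2 + r\<^sup>2 * ((cos t)\<^sup>2 + (sin t)\<^sup>2) + 2 * (Re a * (r * cos t) + Im a * (r * sin t))"
      by (simp only: power2_eq_square algebra_simps)
    also have "\<dots> = Re (of_real ((cmod a)\<^sup>2 + r\<^sup>2) + 2 * cnj a * (?y - a))"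
      by (simp add: cmod_power2)
    finally have "Re (G ?y) = v a + Re (f ?y) - \<epsilon> * (cmod ?y)\<^sup>2" by (simp add: G_def)
    then show ?thesis using a(2)[OF y(2)] f(3)[OF y(1)] by (simp add: v_def k_def)
  qed
  have "(\<lambda>t. p (a + of_real r * cis t)) integrable_on {0..2 * pi}"
       "p a \<le> 1 / (2 * pi) * integral {0..2 * pi} (\<lambda>t. p (a + of_real r * cis t))"
    using sub r(1) by (auto simp: subharmonic_def intro: set_lebesgue_integral_eq_integral)
  note int_p = this
  from int_p(1) have "integral {0..2 * pi} (\<lambda>t. p (a + of_real r * cis t)) \<le> 2 * pi * Re (G a)"
    using integral_le[OF _ has_integral_integrable[OF int] le] integral_unique[OF int] by simp
  then have "1 / (2 * pi) * integral {0..2 * pi} (\<lambda>t. p (a + of_real r * cis t)) \<le> 1 / (2 * pi) * (2 * pi * Re (G a))"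
    by (intro mult_left_mono) auto
  with int_p(2) have "p a \<le> Re (G a)" by simp
  also have "\<dots> = v a + h a - \<epsilon> * ((cmod a)\<^sup>2 + r\<^sup>2)" using f by (simp add: G_def)
  also have "\<dots> = p a - \<epsilon> * r\<^sup>2" by (simp add: v_def k_def algebra_simps)
  finally have "p a \<le> p a - \<epsilon> * r\<^sup>2" .
  moreover have "\<epsilon> * r\<^sup>2 > 0" using eps(1) r(1) by (intro mult_pos_pos zero_less_power)
  ultimately show False by linarith
qed

lemma subharmonic_radial_mono:
  assumes "subharmonic p" "radial p" "cmod x \<le> cmod y"
  shows "p x \<le> p y"
proof (cases "y = 0")
  case False
  show ?thesis
  proof (rule subharmonic_le_harmonic_majorant[OF assms(1), of "cball 0 (cmod y)" "\<lambda>_. p y"])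
    fix z :: complex assume "z \<in> cball 0 (cmod y) - interior (cball 0 (cmod y))"
    then have "cmod z = cmod y" by auto
    then show "p z \<le> p y" using assms(2) unfolding radial_def by (metis order_refl)
  next
    fix a
    show "\<exists>R>0. \<exists>f. f holomorphic_on ball a R \<and> (\<forall>x\<in>ball a R. p y = Re (f x))"
      by (intro exI[of _ 1] exI[of _ "\<lambda>_. of_real (p y)"] conjI) auto
  qed (use assms in auto)
qed (use assms in auto)

text \<open>
  The logarithm of \<open>x / a\<close> is holomorphic on the largest disc about \<open>a\<close> that avoids the origin.
\<close>

lemma ln_norm_locally_harmonic:
  assumes "a \<noteq> 0"
  shows "(\<lambda>x. of_real A + of_real b * (Ln (x / a) + of_real (ln (cmod a)))) holomorphic_on ball a (cmod a) \<and>
    (\<forall>x\<in>ball a (cmod a). A + b * ln (cmod x) = Re (of_real A + of_real b * (Ln (x / a) + of_real (ln (cmod a)))))"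
proof (intro conjI ballI)
  have re: "Re (x / a) > 0" if "x \<in> ball a (cmod a)" for x
  proof -
    have "cmod (1 - x / a) = cmod (a - x) / cmod a"
      using assms by (simp add: diff_divide_distrib flip: norm_divide)
    also have "\<dots> < 1" using that assms by (simp add: dist_norm)
    finally show ?thesis using complex_Re_le_cmod[of "1 - x / a"] by simp
  qed
  have np: "x / a \<notin> \<real>\<^sub>\<le>\<^sub>0" if "x \<in> ball a (cmod a)" for x
    using re[OF that] complex_nonpos_Reals_iff by fastforce
  then show "(\<lambda>x. of_real A + of_real b * (Ln (x / a) + of_real (ln (cmod a)))) holomorphic_on ball a (cmod a)"
    using assms by (intro holomorphic_intros) auto
  fix x assume x: "x \<in> ball a (cmod a)"
  then have "x \<noteq> 0" by auto
  then show "A + b * ln (cmod x) = Re (of_real A + of_real b * (Ln (x / a) + of_real (ln (cmod a))))"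
    using assms by (simp add: norm_divide ln_div)
qed

text \<open>
  Hadamard's three circles theorem for \<open>p\<close>: on an annulus, \<open>p\<close> lies below the function
  \<open>A + b ln |z|\<close> that agrees with it on both boundary circles.
\<close>

lemma subharmonic_radial_log_convex:
  assumes sub: "subharmonic p" and rad: "radial p"
  shows "convex_on UNIV (\<lambda>x. p (of_real (exp x)))"
proof (rule convex_on_linorderI)
  fix t x y :: real assume t: "t > 0" "t < 1" and xy: "x < y"
  define q where "q x = p (of_real (exp x))" for x
  define b where "b = (q y - q x) / (y - x)"
  define A where "A = q x - b * x"
  have hby: "A + b * y = q y" 
  proof -
    have "b * (y - x) = q y - q x" using xy by (simp add: b_def)
    then show ?thesis by (simp add: A_def algebra_simps)
  qed
  define s where "s = (1 - t) * x + t * y"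
  have "s - x = t * (y - x)" "y - s = (1 - t) * (y - x)" by (simp_all add: s_def algebra_simps)
  then have s: "x < s" "s < y" using t xy by (metis diff_gt_0_iff_gt mult_pos_pos)+
  define K where "K = {z. exp x \<le> cmod z \<and> cmod z \<le> exp y}"
  have eq: "K = cball 0 (exp y) \<inter> {z. exp x \<le> cmod z}" by (auto simp: K_def)
  have "p (of_real (exp s)) \<le> A + b * ln (cmod (of_real (exp s)))"
  proof (rule subharmonic_le_harmonic_majorant[OF sub, of K "\<lambda>z. A + b * ln (cmod z)"])
    show "compact K" unfolding eq
      by (intro compact_Int_closed compact_cball closed_Collect_le continuous_intros)
    have "z \<noteq> 0" if "z \<in> K" for z using that unfolding K_def by (metis (mono_tags, lifting) exp_gt_zero linorder_not_le mem_Collect_eq norm_zero)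
    then show "continuous_on K (\<lambda>z. A + b * ln (cmod z))" by (intro continuous_intros) auto
    show "of_real (exp s) \<in> K" using s by (simp add: K_def)
    {
      fix a assume "a \<in> interior K"
      then have "a \<in> K" using interior_subset by auto
      then have "a \<noteq> 0" using \<open>\<And>z. z \<in> K \<Longrightarrow> z \<noteq> 0\<close> by auto
      then have "cmod a > 0" by simp
      with ln_norm_locally_harmonic[OF \<open>a \<noteq> 0\<close>, of A b]
      show "\<exists>R>0. \<exists>f. f holomorphic_on ball a R \<and> (\<forall>x\<in>ball a R. A + b * ln (cmod x) = Re (f x))"
        by blast
    next
      fix z assume z: "z \<in> K - interior K"
      have "{z. exp x < cmod z} \<inter> {z. cmod z < exp y} \<subseteq> interior K"
        by (intro interior_maximal open_Int open_Collect_less continuous_intros) (auto simp: K_def)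
      then have "\<not> (exp x < cmod z \<and> cmod z < exp y)" using z by blast
      with z have "cmod z = exp x \<or> cmod z = exp y" by (simp add: K_def) linarith
      moreover have "p z = p (of_real (cmod z))" using rad by (simp add: radial_def)
      ultimately show "p z \<le> A + b * ln (cmod z)" using hby by (auto simp: q_def A_def)
    }
  qed
  also have "\<dots> = (1 - t) * q x + t * q y" using hby by (simp add: A_def s_def flip: hby) (simp add: algebra_simps)
  finally show "p (of_real (exp ((1 - t) *\<^sub>R x + t *\<^sub>R y))) \<le> (1 - t) * p (of_real (exp x)) + t * p (of_real (exp y))"
    by (simp add: q_def s_def)
qed auto

lemma subharmonic_radial_supporting_slope:
  assumes sub: "subharmonic p" and rad: "radial p" and a: "a \<noteq> 0"
  obtains \<beta> where "\<beta> \<ge> 0" "\<And>x. x \<noteq> 0 \<Longrightarrow> p a + \<beta> * ln (cmod x / cmod a) \<le> p x"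
proof -
  define q where "q x = p (of_real (exp x))" for x :: real
  define x0 where "x0 = ln (cmod a)"
  define \<beta> where "\<beta> = Inf ((\<lambda>t. (q x0 - q t) / (x0 - t)) ` ({x0<..} \<inter> UNIV))"
  have sup: "q x0 + \<beta> * (y - x0) \<le> q y" for y
    unfolding \<beta>_def using subharmonic_radial_log_convex[OF sub rad]
    by (intro convex_le_Inf_differential) (auto simp: q_def)
  have pq: "p x = q (ln (cmod x))" if "x \<noteq> 0" for x
    using rad that unfolding q_def radial_def by (metis exp_ln zero_less_norm_iff)
  have "q (x0 - 1) \<le> q x0" unfolding q_def
    by (intro subharmonic_radial_mono[OF sub rad]) simp
  with sup[of "x0 - 1"] have "\<beta> \<ge> 0" by simp
  moreover have "p a + \<beta> * ln (cmod x / cmod a) \<le> p x" if "x \<noteq> 0" for x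
    using sup[of "ln (cmod x)"] pq[OF that] pq[OF a] that a by (simp add: x0_def ln_div)
  ultimately show ?thesis using that by blast
qed

section \<open>Counting nodes\<close>

text \<open>
  The hypotheses in the form in which they are used, for \<open>P = p + 1\<close>. The sum in \<open>weighted_count\<close> is the
  integral of \<open>n(0,t)\<close> over \<open>[0,|x|]\<close>, and \<open>separation\<close> is what \<open>N(z\<^sub>j,e) = O(P(z\<^sub>j))\<close> says about the nodes
  at distance less than 1. Working with \<open>P \<ge> 1\<close> absorbs all additive constants.
\<close>

locale sparse_points =
  fixes P :: "complex \<Rightarrow> real" and z :: "nat \<Rightarrow> complex" and m :: "nat \<Rightarrow> nat" and K L Q :: real
  assumes P_ge_1: "1 \<le> P x"
    and P_mono: "cmod x \<le> cmod y \<Longrightarrow> P x \<le> P y"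
    and P_step: "cmod y \<le> cmod x + 1 \<Longrightarrow> P y \<le> K * P x"
    and P_log: "1 + (cmod x)\<^sup>2 \<le> exp (L * P x)"
    and P_slope: "1 \<le> cmod a \<Longrightarrow> \<exists>\<beta>\<ge>0. \<forall>x. x \<noteq> 0 \<longrightarrow> P a + \<beta> * ln (cmod x / cmod a) \<le> P x"
    and inj_z: "inj z" and m_pos: "m j > 0"
    and finite_disc: "finite {k. cmod (z k) \<le> s}"
    and weighted_count: "(\<Sum>k | cmod (z k) \<le> cmod x. m k * (cmod x - cmod (z k))) \<le> Q * P x"
    and separation:
      "(\<Sum>k | k \<noteq> j \<and> cmod (z j - z k) < 1. m k * ln (1 / cmod (z j - z k))) \<le> Q * P (z j)"
begin

lemma P_pos: "0 < P x" using P_ge_1[of x] by linarith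

lemma K_ge_1: "1 \<le> K"
  using P_step[of 0 0] P_pos[of 0] by simp

lemma L_nonneg: "0 \<le> L"
  using P_log[of 0] P_pos[of 0] by (simp add: zero_le_mult_iff)

lemma Q_nonneg: "0 \<le> Q"
proof -
  have "0 \<le> (\<Sum>k | cmod (z k) \<le> cmod 0. m k * (cmod 0 - cmod (z k)))"
    by (intro sum_nonneg mult_nonneg_nonneg) auto
  also have "\<dots> \<le> Q * P 0" by (rule weighted_count)
  finally show ?thesis using P_pos[of 0] by (simp add: zero_le_mult_iff)
qed

lemma P_steps: "cmod y \<le> cmod x + real i \<Longrightarrow> P y \<le> K ^ i * P x"
proof (induction i arbitrary: y)
  case 0
  then show ?case using P_mono by simp
next
  case (Suc i)
  let ?y = "of_real (cmod x + real i) :: complex"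
  have y: "cmod ?y = cmod x + real i" by (simp only: norm_of_real) simp
  then have "P y \<le> K * P ?y" using Suc.prems by (intro P_step) simp
  also have "\<dots> \<le> K * (K ^ i * P x)" using y K_ge_1 by (intro mult_left_mono Suc.IH) auto
  finally show ?case by simp
qed

lemma weighted_count_le:
  assumes "finite S" "\<And>k. k \<in> S \<Longrightarrow> cmod (z k) \<le> cmod x"
  shows "(\<Sum>k\<in>S. m k * (cmod x - cmod (z k))) \<le> Q * P x"
proof -
  have "(\<Sum>k\<in>S. m k * (cmod x - cmod (z k))) \<le> (\<Sum>k | cmod (z k) \<le> cmod x. m k * (cmod x - cmod (z k)))"
    using assms by (intro sum_mono2 finite_disc) auto
  then show ?thesis using weighted_count[of x] by linarith
qed

text \<open>
  In the disc that is larger by 1 every node of the given disc has weight at least 1.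
\<close>

lemma count_le:
  assumes "finite S" "\<And>k. k \<in> S \<Longrightarrow> cmod (z k) \<le> cmod x"
  shows "(\<Sum>k\<in>S. real (m k)) \<le> Q * K * P x"
proof -
  let ?y = "of_real (cmod x + 1) :: complex"
  have y: "cmod ?y = cmod x + 1" by (simp only: norm_of_real) simp
  have "(\<Sum>k\<in>S. real (m k)) \<le> (\<Sum>k\<in>S. m k * (cmod ?y - cmod (z k)))"
  proof (rule sum_mono)
    fix k assume "k \<in> S"
    then have "1 \<le> cmod ?y - cmod (z k)" using assms(2) y by force
    from mult_left_mono[OF this, of "real (m k)"] show "real (m k) \<le> m k * (cmod ?y - cmod (z k))" by simp
  qed
  also have "\<dots> \<le> Q * P ?y"
  proof (rule weighted_count_le[OF assms(1)])
    show "cmod (z k) \<le> cmod ?y" if "k \<in> S" for k using assms(2)[OF that] y by linarith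
  qed
  also have "\<dots> \<le> Q * (K * P x)" using y Q_nonneg by (intro mult_left_mono P_step) auto
  finally show ?thesis by (simp add: mult.assoc)
qed

lemma m_le: "real (m j) \<le> Q * K * P (z j)"
  using count_le[of "{j}" "z j"] by simp

lemma sum_half_powers_le: "finite I \<Longrightarrow> (\<Sum>i\<in>I. (1/2) ^ i) \<le> (2::real)" for I :: "nat set"
  using sum_le_suminf[of "\<lambda>i. (1/2::real) ^ i" I] suminf_geometric[of "1/2::real"]
  by (simp add: summable_geometric)

text \<open>
  The rate \<open>lam\<close> is such that \<open>exp (- lam t)\<close> beats the growth of \<open>P\<close>, which is at most by the factor \<open>K\<close> per
  unit of \<open>t\<close>.
\<close>

definition lam :: real where "lam = 2 + ln (2 * K)"

lemma lam_ge_2: "2 \<le> lam"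
  using K_ge_1 by (simp add: lam_def)

lemma exp_lam: "2 * K \<le> exp lam"
proof -
  have "2 * K = exp (ln (2 * K))" using K_ge_1 by simp
  also have "\<dots> \<le> exp lam" by (simp add: lam_def)
  finally show ?thesis .
qed

text \<open>
  The nodes are grouped by the integer part \<open>l\<close> of \<open>|z\<^sub>k| - |x|\<close>. Counted with
  multiplicity, the \<open>l\<close>-th group has at most \<open>Q K P(|x| + l + 1)\<close>, hence at most \<open>Q K\<^sup>2 K^l P(x)\<close> elements,
  and for each of them the exponential is at most \<open>(2 K)^(- l)\<close>.
\<close>

lemma tail_le:
  assumes "finite S" "\<And>k. k \<in> S \<Longrightarrow> cmod x \<le> cmod (z k)"
  shows "(\<Sum>k\<in>S. m k * exp (- lam * (cmod (z k) - cmod x))) \<le> 2 * Q * K\<^sup>2 * P x"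
proof -
  define i where "i k = nat \<lfloor>cmod (z k) - cmod x\<rfloor>" for k
  have i: "real (i k) \<le> cmod (z k) - cmod x" "cmod (z k) \<le> cmod x + real (Suc (i k))" if "k \<in> S" for k
    using assms(2)[OF that] unfolding i_def by linarith+
  have "(\<Sum>k\<in>S. m k * exp (- lam * (cmod (z k) - cmod x)))
      = (\<Sum>l\<in>i ` S. \<Sum>k | k \<in> S \<and> i k = l. m k * exp (- lam * (cmod (z k) - cmod x)))"
    by (rule sum.image_gen[OF assms(1)])
  also have "\<dots> \<le> (\<Sum>l\<in>i ` S. (Q * K\<^sup>2 * P x) * (1/2) ^ l)"
  proof (rule sum_mono)
    fix l assume "l \<in> i ` S"
    have e: "exp (- lam * (cmod (z k) - cmod x)) \<le> (1 / (2 * K)) ^ l" if "k \<in> S" "i k = l" for k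
    proof -
      have "exp (- lam * (cmod (z k) - cmod x)) \<le> exp (- lam * real l)"
        using i(1)[OF that(1)] that(2) lam_ge_2 by simp
      also have "\<dots> = exp (- lam) ^ l" by (rule exp_of_nat2_mult)
      also have "\<dots> = (1 / exp lam) ^ l" by (simp add: exp_minus divide_inverse)
      also have "\<dots> \<le> (1 / (2 * K)) ^ l" using exp_lam K_ge_1 by (intro power_mono divide_left_mono) auto
      finally show ?thesis .
    qed
    let ?T = "{k \<in> S. i k = l}"
    let ?y = "of_real (cmod x + real (Suc l)) :: complex"
    have y: "cmod ?y = cmod x + real (Suc l)" by (simp only: norm_of_real) simp
    have "(\<Sum>k\<in>?T. m k * exp (- lam * (cmod (z k) - cmod x))) \<le> (\<Sum>k\<in>?T. m k * (1 / (2 * K)) ^ l)"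
      using e by (intro sum_mono mult_left_mono) auto
    also have "\<dots> = (\<Sum>k\<in>?T. real (m k)) * (1 / (2 * K)) ^ l" by (simp add: sum_distrib_right)
    also have "\<dots> \<le> (Q * K * P ?y) * (1 / (2 * K)) ^ l"
      using assms(1) i(2) y K_ge_1 by (intro mult_right_mono count_le) auto
    also have "\<dots> \<le> (Q * K * (K ^ Suc l * P x)) * (1 / (2 * K)) ^ l"
      using Q_nonneg K_ge_1 y by (intro mult_right_mono mult_left_mono P_steps) auto
    also have "\<dots> = (Q * K\<^sup>2 * P x) * (1/2) ^ l"
      using K_ge_1 by (simp add: power_divide power_mult_distrib power2_eq_square)
    finally show "(\<Sum>k\<in>?T. m k * exp (- lam * (cmod (z k) - cmod x))) \<le> (Q * K\<^sup>2 * P x) * (1/2) ^ l" .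
  qed
  also have "\<dots> = (Q * K\<^sup>2 * P x) * (\<Sum>l\<in>i ` S. (1/2) ^ l)" by (simp add: sum_distrib_left)
  also have "\<dots> \<le> (Q * K\<^sup>2 * P x) * 2"
    using assms(1) Q_nonneg P_pos[of x] by (intro mult_left_mono sum_half_powers_le) auto
  finally show ?thesis by simp
qed

text \<open>
  The nodes are grouped by the integer part \<open>l\<close> of \<open>|z\<^sub>j|\<close>. Up to a constant, one factor \<open>exp (- P)\<close> outweighs the
  number of nodes in a group, and the others give \<open>exp (- L P) \<le> 1 / (1 + l\<^sup>2)\<close>.
\<close>

lemma sum_exp_P_bounded:
  obtains T where "T \<ge> 0" "\<And>S. finite S \<Longrightarrow> (\<Sum>j\<in>S. exp (- (L + 1) * P (z j))) \<le> T"
proof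
  define c where "c i = Q * K\<^sup>2 * (1 / (1 + (real i)\<^sup>2))" for i :: nat
  have "summable (\<lambda>i. inverse ((real i)\<^sup>2))" by (rule inverse_power_summable) auto
  then have "summable (\<lambda>i. 1 / (1 + (real i)\<^sup>2))"
  proof (rule summable_comparison_test'[where N = 1])
    fix i :: nat assume "i \<ge> 1"
    then have "inverse (1 + (real i)\<^sup>2) \<le> inverse ((real i)\<^sup>2)"
      by (intro le_imp_inverse_le) auto
    then show "norm (1 / (1 + (real i)\<^sup>2)) \<le> inverse ((real i)\<^sup>2)"
      by (simp add: divide_inverse)
  qed
  then have sc: "summable c" unfolding c_def by (rule summable_mult)
  have c0: "c i \<ge> 0" for i unfolding c_def using Q_nonneg by simp
  show "suminf c \<ge> 0" using sc c0 by (intro suminf_nonneg)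
  fix S :: "nat set" assume S: "finite S"
  define i where "i k = nat \<lfloor>cmod (z k)\<rfloor>" for k
  have i: "real (i k) \<le> cmod (z k)" "cmod (z k) \<le> real (Suc (i k))" for k
    using norm_ge_zero[of "z k"] unfolding i_def by linarith+
  have "(\<Sum>j\<in>S. exp (- (L + 1) * P (z j))) = (\<Sum>l\<in>i ` S. \<Sum>j | j \<in> S \<and> i j = l. exp (- (L + 1) * P (z j)))"
    by (rule sum.image_gen[OF S])
  also have "\<dots> \<le> (\<Sum>l\<in>i ` S. c l)"
  proof (rule sum_mono)
    fix l
    let ?T = "{k \<in> S. i k = l}"
    let ?x = "of_real (real l) :: complex" and ?y = "of_real (real (Suc l)) :: complex"
    have xy: "cmod ?x = real l" "cmod ?y = real (Suc l)" unfolding norm_of_real by simp_all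
    have "(\<Sum>j\<in>?T. exp (- (L + 1) * P (z j))) \<le> (\<Sum>j\<in>?T. real (m j) * exp (- (L + 1) * P ?x))"
    proof (rule sum_mono)
      fix k assume k: "k \<in> ?T"
      have "P ?x \<le> P (z k)" using i(1)[of k] k xy by (intro P_mono) auto
      then have "exp (- (L + 1) * P (z k)) \<le> 1 * exp (- (L + 1) * P ?x)" using L_nonneg
        by (simp add: mult_left_mono)
      also have "\<dots> \<le> real (m k) * exp (- (L + 1) * P ?x)"
        using m_pos[of k] by (intro mult_right_mono) auto
      finally show "exp (- (L + 1) * P (z k)) \<le> real (m k) * exp (- (L + 1) * P ?x)" .
    qed
    also have "\<dots> = (\<Sum>j\<in>?T. real (m j)) * exp (- (L + 1) * P ?x)" by (simp add: sum_distrib_right)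
    also have "\<dots> \<le> (Q * K * P ?y) * exp (- (L + 1) * P ?x)"
      using S i(2) xy by (intro mult_right_mono count_le) auto
    also have "\<dots> \<le> (Q * K * (K * exp (P ?x))) * exp (- (L + 1) * P ?x)"
    proof (intro mult_right_mono mult_left_mono)
      have "P ?y \<le> K * P ?x" using xy by (intro P_step) auto
      also have "\<dots> \<le> K * exp (P ?x)"
        using K_ge_1 exp_ge_add_one_self[of "P ?x"] by (intro mult_left_mono) linarith+
      finally show "P ?y \<le> K * exp (P ?x)" .
    qed (use Q_nonneg K_ge_1 in auto)
    also have "\<dots> = Q * K\<^sup>2 * exp (- (L * P ?x))"
      by (simp add: power2_eq_square algebra_simps flip: exp_add)
    also have "\<dots> \<le> c l"
    proof -
      have "1 / exp (L * P ?x) \<le> 1 / (1 + (real l)\<^sup>2)"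
        using P_log[of ?x] xy by (intro divide_left_mono mult_pos_pos) (auto simp: add_pos_nonneg)
      then show ?thesis unfolding c_def using Q_nonneg
        by (intro mult_left_mono) (auto simp: exp_minus divide_inverse)
    qed
    finally show "(\<Sum>j\<in>?T. exp (- (L + 1) * P (z j))) \<le> c l" .
  qed
  also have "\<dots> \<le> suminf c" using S by (intro sum_le_suminf[OF sc] c0) auto
  finally show "(\<Sum>j\<in>S. exp (- (L + 1) * P (z j))) \<le> suminf c" .
qed

end

section \<open>Products with zeros at all nodes but one\<close>

text \<open>
  The convention at the origin makes \<open>cnj_dir_mult\<close> hold for all \<open>a\<close>.
\<close>

definition dir :: "complex \<Rightarrow> complex" where
  "dir a = (if a = 0 then 1 else sgn a)"

lemma norm_dir [simp]: "cmod (dir a) = 1"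
  by (simp add: dir_def norm_sgn)

lemma cnj_dir_mult: "cnj (dir a) * a = of_real (cmod a)"
proof (cases "a = 0")
  case False
  have "cnj (sgn a) * a = a * cnj a / of_real (cmod a)"
    by (simp add: sgn_eq)
  also have "\<dots> = of_real (cmod a)" using False
    by (simp add: complex_norm_square[symmetric] power2_eq_square flip: of_real_divide)
  finally show ?thesis using False by (simp add: dir_def)
qed (simp add: dir_def)

lemma Re_cnj_dir_le: "Re (cnj (dir a) * (x - a)) \<le> cmod x - cmod a"
proof -
  have "Re (cnj (dir a) * x) \<le> cmod (cnj (dir a) * x)" by (rule complex_Re_le_cmod)
  then show ?thesis by (simp only: right_diff_distrib cnj_dir_mult) (simp add: norm_mult)
qed

definition exp_factor :: "complex \<Rightarrow> real \<Rightarrow> complex \<Rightarrow> complex" where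
  "exp_factor a \<mu> x = 1 - exp (of_real \<mu> * (cnj (dir a) * (x - a)))"

lemma exp_factor_holomorphic [holomorphic_intros]: "exp_factor a \<mu> holomorphic_on S"
  unfolding exp_factor_def by (intro holomorphic_intros)

lemma exp_factor_zero [simp]: "exp_factor a \<mu> a = 0"
  by (simp add: exp_factor_def)

lemma norm_exp_dir_le:
  assumes "0 \<le> \<mu>"
  shows "cmod (exp (of_real \<mu> * (cnj (dir a) * (x - a)))) \<le> exp (\<mu> * (cmod x - cmod a))"
proof -
  have "Re (of_real \<mu> * (cnj (dir a) * (x - a))) = \<mu> * Re (cnj (dir a) * (x - a))" by simp
  also have "\<dots> \<le> \<mu> * (cmod x - cmod a)" using assms Re_cnj_dir_le by (intro mult_left_mono)
  finally show ?thesis by simp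
qed

lemma exp_factor_upper_outside:
  assumes "0 \<le> \<mu>" "\<mu> \<le> c" "cmod a \<le> cmod x"
  shows "cmod (exp_factor a \<mu> x) \<le> exp (c * (cmod x - cmod a) + 1)"
proof -
  let ?t = "c * (cmod x - cmod a)"
  have "cmod (exp_factor a \<mu> x) \<le> 1 + cmod (exp (of_real \<mu> * (cnj (dir a) * (x - a))))"
    unfolding exp_factor_def using norm_triangle_ineq4[of 1 "exp (of_real \<mu> * (cnj (dir a) * (x - a)))"] by simp
  also have "\<dots> \<le> 1 + exp (\<mu> * (cmod x - cmod a))"
    using norm_exp_dir_le[OF assms(1)] by simp
  also have "\<dots> \<le> 1 + exp ?t" using assms by (simp add: mult_right_mono)
  also have "\<dots> \<le> exp ?t + exp ?t" using assms by simp
  also have "\<dots> \<le> exp ?t * exp 1" using exp_ge_add_one_self[of 1] by simp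
  finally show ?thesis by (simp add: exp_add)
qed

lemma exp_factor_upper_inside:
  assumes "0 \<le> c" "c \<le> \<mu>" "cmod x \<le> cmod a"
  shows "cmod (exp_factor a \<mu> x) \<le> exp (exp (- c * (cmod a - cmod x)))"
proof -
  have "cmod (exp_factor a \<mu> x) \<le> 1 + cmod (exp (of_real \<mu> * (cnj (dir a) * (x - a))))"
    unfolding exp_factor_def using norm_triangle_ineq4[of 1 "exp (of_real \<mu> * (cnj (dir a) * (x - a)))"] by simp
  also have "\<dots> \<le> 1 + exp (\<mu> * (cmod x - cmod a))"
    using norm_exp_dir_le[of \<mu>] assms by simp
  also have "\<mu> * (cmod x - cmod a) \<le> - c * (cmod a - cmod x)"
    using mult_right_mono[OF assms(2), of "cmod a - cmod x"] assms by (simp add: algebra_simps)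
  then have "1 + exp (\<mu> * (cmod x - cmod a)) \<le> 1 + exp (- c * (cmod a - cmod x))" by simp
  also have "\<dots> \<le> exp (exp (- c * (cmod a - cmod x)))" by (rule exp_ge_add_one_self)
  finally show ?thesis .
qed

lemma one_minus_ge_exp:
  fixes t :: real
  assumes "0 \<le> t" "t \<le> 1/2" shows "exp (- 2 * t) \<le> 1 - t"
proof -
  have "- 2 * t \<le> - t - 2 * t\<^sup>2" using assms mult_left_mono[OF assms(2,1)] by (simp add: power2_eq_square)
  also have "\<dots> \<le> ln (1 - t)" using assms by (rule ln_one_minus_pos_lower_bound)
  finally have "exp (- 2 * t) \<le> exp (ln (1 - t))" by simp
  then show ?thesis using assms by simp
qed

text \<open>
  Here the point \<open>x\<close> is close to the node \<open>b\<close>, and \<open>a\<close> is a node farther out by at least 1: the exponential in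
  the factor is small, and the factor is close to 1.
\<close>

lemma exp_factor_lower_inside:
  assumes "2 \<le> c" "c \<le> \<mu>" "cmod b + 1 \<le> cmod a" "cmod x \<le> cmod b + 1 / (13 * c)"
  shows "exp (- 6 * exp (- c * (cmod a - cmod b))) \<le> cmod (exp_factor a \<mu> x)"
proof -
  let ?d = "cmod a - cmod b"
  have q: "1 / (13 * c) \<le> 1/26" using assms(1) by (simp add: field_simps)
  have "c * (cmod a - cmod x) \<le> \<mu> * (cmod a - cmod x)"
    using assms q by (intro mult_right_mono) linarith+
  moreover have "c * (?d - 1 / (13 * c)) \<le> c * (cmod a - cmod x)"
    using assms by (intro mult_left_mono) auto
  moreover have "c * (?d - 1 / (13 * c)) = c * ?d - 1/13" using assms(1) by (simp add: right_diff_distrib)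
  ultimately have y: "\<mu> * (cmod x - cmod a) \<le> 1 - c * ?d" by (simp add: right_diff_distrib)
  define t where "t = exp (1 - c * ?d)"
  have "c * 1 \<le> c * ?d" using assms by (intro mult_left_mono) auto
  then have "1 - c * ?d \<le> -1" using assms(1) by linarith
  then have "t \<le> exp (-1)" by (simp only: t_def exp_le_cancel_iff)
  also have "exp (-1::real) \<le> 1/2"
    using exp_ge_add_one_self[of 1] by (simp add: exp_minus field_simps)
  finally have t: "0 \<le> t" "t \<le> 1/2" by (auto simp: t_def)
  have "t = exp 1 * exp (- c * ?d)" by (simp add: t_def exp_diff exp_minus divide_inverse)
  also have "\<dots> \<le> 3 * exp (- c * ?d)" using exp_le by (intro mult_right_mono) auto
  finally have "exp (- 6 * exp (- c * ?d)) \<le> exp (- 2 * t)" by simp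
  also have "\<dots> \<le> 1 - t" by (rule one_minus_ge_exp[OF t])
  also have "\<dots> \<le> 1 - cmod (exp (of_real \<mu> * (cnj (dir a) * (x - a))))"
  proof -
    have "cmod (exp (of_real \<mu> * (cnj (dir a) * (x - a)))) \<le> exp (\<mu> * (cmod x - cmod a))"
      using assms by (intro norm_exp_dir_le) auto
    also have "\<dots> \<le> t" using y by (simp add: t_def)
    finally show ?thesis by simp
  qed
  also have "\<dots> \<le> cmod (exp_factor a \<mu> x)"
    unfolding exp_factor_def using norm_triangle_ineq2[of 1 "exp (of_real \<mu> * (cnj (dir a) * (x - a)))"] by simp
  finally show ?thesis .
qed

text \<open>
  The exponent \<open>\<mu>\<close> is adapted to the position of \<open>b\<close> relative to the tangent line at \<open>a\<close> that carries the zeros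
  of the factor.
\<close>

lemma exp_factor_lower_near:
  assumes "1 \<le> c"
  obtains \<mu> where "c \<le> \<mu>" "\<mu> \<le> 13 * c"
    "\<And>x. cmod (x - b) \<le> 1 / (13 * c) \<Longrightarrow> cmod (x - b) \<le> cmod (b - a) / 2 \<Longrightarrow>
       min 1 (cmod (b - a)) / 16 \<le> cmod (exp_factor a \<mu> x)"
proof -
  obtain \<nu> where \<nu>: "1 \<le> \<nu>" "\<nu> \<le> 13"
    "\<And>x. cmod (x - of_real c * (cnj (dir a) * (b - a))) \<le> 1/13 \<Longrightarrow>
      min 1 (cmod x) / 8 \<le> cmod (1 - exp (of_real \<nu> * x))"
    using dilation_avoiding_zeros by blast
  have "min 1 (cmod (b - a)) / 16 \<le> cmod (exp_factor a (\<nu> * c) x)"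
    if x: "cmod (x - b) \<le> 1 / (13 * c)" "cmod (x - b) \<le> cmod (b - a) / 2" for x
  proof -
    let ?y = "of_real c * (cnj (dir a) * (x - a))"
    have "?y - of_real c * (cnj (dir a) * (b - a)) = of_real c * cnj (dir a) * (x - b)"
      by (simp add: algebra_simps)
    then have "cmod (?y - of_real c * (cnj (dir a) * (b - a))) = c * cmod (x - b)"
      using assms by (simp add: norm_mult)
    also have "\<dots> \<le> c * (1 / (13 * c))" using x assms by (intro mult_left_mono) auto
    finally have "min 1 (cmod ?y) / 8 \<le> cmod (1 - exp (of_real \<nu> * ?y))"
      using assms by (intro \<nu>(3)) simp
    also have "1 - exp (of_real \<nu> * ?y) = exp_factor a (\<nu> * c) x" by (simp add: exp_factor_def mult.assoc)
    finally have 1: "min 1 (cmod ?y) / 8 \<le> cmod (exp_factor a (\<nu> * c) x)" .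
    have "cmod (b - a) \<le> cmod (x - a) + cmod (x - b)"
      using norm_triangle_ineq4[of "x - a" "x - b"] by simp
    then have "cmod (b - a) / 2 \<le> 1 * cmod (x - a)" using x(2) by simp
    also have "\<dots> \<le> c * cmod (x - a)" using assms by (intro mult_right_mono) auto
    also have "\<dots> = cmod ?y" using assms by (simp add: norm_mult)
    finally show ?thesis using 1 by (simp add: min_def split: if_splits)
  qed
  moreover have "c \<le> \<nu> * c" "\<nu> * c \<le> 13 * c" using \<nu> assms by auto
  ultimately show ?thesis using that by blast
qed

lemma exp_sum_le_prod:
  fixes f :: "'a \<Rightarrow> real"
  assumes "\<And>k. k \<in> S \<Longrightarrow> exp (- f k) \<le> g k"
  shows "exp (- (\<Sum>k\<in>S. real (m k) * f k)) \<le> (\<Prod>k\<in>S. g k ^ m k)"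
proof (cases "finite S")
  case True
  have "exp (- (\<Sum>k\<in>S. real (m k) * f k)) = (\<Prod>k\<in>S. exp (- f k) ^ m k)"
    using True by (simp add: sum_negf[symmetric] exp_sum exp_of_nat_mult[symmetric])
  also have "\<dots> \<le> (\<Prod>k\<in>S. g k ^ m k)" using assms by (intro prod_mono conjI power_mono) auto
  finally show ?thesis .
qed simp

lemma prod_le_exp_sum:
  fixes f :: "'a \<Rightarrow> real"
  assumes "\<And>k. k \<in> S \<Longrightarrow> 0 \<le> g k" "\<And>k. k \<in> S \<Longrightarrow> g k \<le> exp (f k)"
  shows "(\<Prod>k\<in>S. g k ^ m k) \<le> exp (\<Sum>k\<in>S. real (m k) * f k)"
proof (cases "finite S")
  case True
  have "(\<Prod>k\<in>S. g k ^ m k) \<le> (\<Prod>k\<in>S. exp (f k) ^ m k)"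
    using assms by (intro prod_mono conjI power_mono) auto
  also have "\<dots> = exp (\<Sum>k\<in>S. real (m k) * f k)"
    using True by (simp add: exp_sum exp_of_nat_mult[symmetric])
  finally show ?thesis .
qed simp

context sparse_points
begin

text \<open>
  A node in the disc of radius \<open>|x|\<close> contributes at most \<open>m\<^sub>k (13 lam (|x| - |z\<^sub>k|) + 1)\<close> to the exponent, one outside
  contributes at most \<open>m\<^sub>k exp (- lam (|z\<^sub>k| - |x|))\<close>.
\<close>

lemma product_upper:
  assumes "finite S" "\<And>k. lam \<le> \<mu> k" "\<And>k. \<mu> k \<le> 13 * lam"
  shows "cmod (\<Prod>k\<in>S. exp_factor (z k) (\<mu> k) x ^ m k) \<le> exp ((13 * lam * Q + Q * K + 2 * Q * K\<^sup>2) * P x)"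
proof -
  define f where "f k = (if cmod (z k) \<le> cmod x then 13 * lam * (cmod x - cmod (z k)) + 1
      else exp (- lam * (cmod (z k) - cmod x)))" for k
  define S1 where "S1 = {k\<in>S. cmod (z k) \<le> cmod x}"
  define S2 where "S2 = {k\<in>S. \<not> cmod (z k) \<le> cmod x}"
  have S: "S = S1 \<union> S2" "S1 \<inter> S2 = {}" "finite S1" "finite S2" using assms(1) by (auto simp: S1_def S2_def)
  have "cmod (\<Prod>k\<in>S. exp_factor (z k) (\<mu> k) x ^ m k) = (\<Prod>k\<in>S. cmod (exp_factor (z k) (\<mu> k) x) ^ m k)"
    by (simp add: prod_norm[symmetric] norm_power)
  also have "\<dots> \<le> exp (\<Sum>k\<in>S. real (m k) * f k)"
  proof (rule prod_le_exp_sum)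
    fix k
    have "0 \<le> \<mu> k" using assms(2)[of k] lam_ge_2 by simp
    then show "cmod (exp_factor (z k) (\<mu> k) x) \<le> exp (f k)"
      using exp_factor_upper_outside[of "\<mu> k" "13 * lam" "z k" x] exp_factor_upper_inside[of lam "\<mu> k" x "z k"]
        assms(2,3)[of k] lam_ge_2 by (auto simp: f_def)
  qed auto
  also have "(\<Sum>k\<in>S. real (m k) * f k) = (\<Sum>k\<in>S1. real (m k) * f k) + (\<Sum>k\<in>S2. real (m k) * f k)"
    unfolding S(1) by (rule sum.union_disjoint) (use S in auto)
  also have "(\<Sum>k\<in>S1. real (m k) * f k) = 13 * lam * (\<Sum>k\<in>S1. m k * (cmod x - cmod (z k))) + (\<Sum>k\<in>S1. real (m k))"
    unfolding sum_distrib_left sum.distrib[symmetric]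
    by (intro sum.cong) (auto simp: f_def S1_def algebra_simps)
  also have "(\<Sum>k\<in>S2. real (m k) * f k) = (\<Sum>k\<in>S2. m k * exp (- lam * (cmod (z k) - cmod x)))"
    by (intro sum.cong) (auto simp: f_def S2_def)
  finally have *: "cmod (\<Prod>k\<in>S. exp_factor (z k) (\<mu> k) x ^ m k) \<le> exp (13 * lam * (\<Sum>k\<in>S1. m k * (cmod x - cmod (z k)))
      + (\<Sum>k\<in>S1. real (m k)) + (\<Sum>k\<in>S2. m k * exp (- lam * (cmod (z k) - cmod x))))" .
  have "13 * lam * (\<Sum>k\<in>S1. m k * (cmod x - cmod (z k))) \<le> 13 * lam * (Q * P x)"
    using S lam_ge_2 by (intro mult_left_mono weighted_count_le) (auto simp: S1_def)
  moreover have "(\<Sum>k\<in>S1. real (m k)) \<le> Q * K * P x"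
    using S by (intro count_le) (auto simp: S1_def)
  moreover have "(\<Sum>k\<in>S2. m k * exp (- lam * (cmod (z k) - cmod x))) \<le> 2 * Q * K\<^sup>2 * P x"
    using S by (intro tail_le) (auto simp: S2_def)
  ultimately have "13 * lam * (\<Sum>k\<in>S1. m k * (cmod x - cmod (z k)))
      + (\<Sum>k\<in>S1. real (m k)) + (\<Sum>k\<in>S2. m k * exp (- lam * (cmod (z k) - cmod x)))
      \<le> (13 * lam * Q + Q * K + 2 * Q * K\<^sup>2) * P x" by (simp add: algebra_simps)
  with * show ?thesis by (meson exp_le_cancel_iff order_trans)
qed

text \<open>
  A node with \<open>|z\<^sub>k| \<le> |z\<^sub>j| + 1\<close> costs a constant, and in addition \<open>ln (1 / |z\<^sub>j - z\<^sub>k|)\<close> if it is closer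
  than 1 to \<open>z\<^sub>j\<close>; the costs of the other nodes decay exponentially.
\<close>

lemma product_lower:
  assumes S: "finite S" "j \<notin> S" and \<mu>: "\<And>k. lam \<le> \<mu> k"
    and near: "\<And>k. k \<in> S \<Longrightarrow> min 1 (cmod (z j - z k)) / 16 \<le> cmod (exp_factor (z k) (\<mu> k) x)"
    and x: "cmod (x - z j) \<le> 1 / (13 * lam)"
  shows "exp (- ((ln 16 * Q * K\<^sup>2 + Q + 12 * Q * K\<^sup>2) * P (z j))) \<le> cmod (\<Prod>k\<in>S. exp_factor (z k) (\<mu> k) x ^ m k)"
proof -
  define f where "f k = (if cmod (z k) \<le> cmod (z j) + 1 then ln 16 + (if cmod (z j - z k) < 1 then ln (1 / cmod (z j - z k)) else 0)
      else 6 * exp (- lam * (cmod (z k) - cmod (z j))))" for k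
  define S1 where "S1 = {k\<in>S. cmod (z k) \<le> cmod (z j) + 1}"
  define S2 where "S2 = {k\<in>S. \<not> cmod (z k) \<le> cmod (z j) + 1}"
  define S0 where "S0 = {k\<in>S1. cmod (z j - z k) < 1}"
  have SS: "S = S1 \<union> S2" "S1 \<inter> S2 = {}" "finite S1" "finite S2" "finite S0"
    using S(1) by (auto simp: S1_def S2_def S0_def)
  have "exp (- (\<Sum>k\<in>S. real (m k) * f k)) \<le> (\<Prod>k\<in>S. cmod (exp_factor (z k) (\<mu> k) x) ^ m k)"
  proof (rule exp_sum_le_prod)
    fix k assume k: "k \<in> S"
    show "exp (- f k) \<le> cmod (exp_factor (z k) (\<mu> k) x)"
    proof (cases "cmod (z k) \<le> cmod (z j) + 1")
      case True
      have "z j \<noteq> z k" using k S(2) inj_z by (auto dest: injD)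
      then have d: "0 < cmod (z j - z k)" by simp
      have "exp (- f k) = min 1 (cmod (z j - z k)) / 16"
      proof (cases "cmod (z j - z k) < 1")
        case lt: True
        have "exp (f k) = 16 * (1 / cmod (z j - z k))"
          using True lt d by (simp only: f_def if_True exp_add) simp
        then show ?thesis using lt by (simp add: exp_minus)
      next
        case ge: False
        have "exp (f k) = 16" using True ge by (simp add: f_def)
        then show ?thesis using ge by (simp add: exp_minus)
      qed
      then show ?thesis using near[OF k] by simp
    next
      case False
      have "cmod x \<le> cmod (z j) + 1 / (13 * lam)"
        using norm_triangle_sub[of x "z j"] x by simp
      then show ?thesis
        using exp_factor_lower_inside[of lam "\<mu> k" "z j" "z k" x] False \<mu>[of k] lam_ge_2 by (simp add: f_def)
    qed
  qed
  also have "\<dots> = cmod (\<Prod>k\<in>S. exp_factor (z k) (\<mu> k) x ^ m k)"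
    by (simp add: prod_norm[symmetric] norm_power)
  finally have *: "exp (- (\<Sum>k\<in>S. real (m k) * f k)) \<le> cmod (\<Prod>k\<in>S. exp_factor (z k) (\<mu> k) x ^ m k)" .
  have "(\<Sum>k\<in>S. real (m k) * f k) = (\<Sum>k\<in>S1. real (m k) * f k) + (\<Sum>k\<in>S2. real (m k) * f k)"
    unfolding SS(1) by (rule sum.union_disjoint) (use SS in auto)
  also have "(\<Sum>k\<in>S1. real (m k) * f k) = ln 16 * (\<Sum>k\<in>S1. real (m k)) + (\<Sum>k\<in>S1. if cmod (z j - z k) < 1 then m k * ln (1 / cmod (z j - z k)) else 0)"
    unfolding sum_distrib_left sum.distrib[symmetric]
    by (intro sum.cong) (auto simp: f_def S1_def algebra_simps)
  also have "(\<Sum>k\<in>S1. if cmod (z j - z k) < 1 then m k * ln (1 / cmod (z j - z k)) else 0)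
      = (\<Sum>k\<in>S0. m k * ln (1 / cmod (z j - z k)))"
    unfolding S0_def using SS by (intro sum.inter_filter[symmetric]) auto
  also have "(\<Sum>k\<in>S2. real (m k) * f k) = 6 * (\<Sum>k\<in>S2. m k * exp (- lam * (cmod (z k) - cmod (z j))))"
    unfolding sum_distrib_left by (intro sum.cong) (auto simp: f_def S2_def)
  finally have eq: "(\<Sum>k\<in>S. real (m k) * f k) = ln 16 * (\<Sum>k\<in>S1. real (m k))
     + (\<Sum>k\<in>S0. m k * ln (1 / cmod (z j - z k))) + 6 * (\<Sum>k\<in>S2. m k * exp (- lam * (cmod (z k) - cmod (z j))))" .
  let ?y = "of_real (cmod (z j) + 1) :: complex"
  have y: "cmod ?y = cmod (z j) + 1" by (simp only: norm_of_real) simp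
  have "(\<Sum>k\<in>S1. real (m k)) \<le> Q * K * P ?y"
    using SS y by (intro count_le) (auto simp: S1_def)
  also have "\<dots> \<le> Q * K * (K * P (z j))" using Q_nonneg K_ge_1 y by (intro mult_left_mono P_step) auto
  finally have "ln 16 * (\<Sum>k\<in>S1. real (m k)) \<le> ln 16 * (Q * K * (K * P (z j)))"
    by (intro mult_left_mono) auto
  moreover have "(\<Sum>k\<in>S0. m k * ln (1 / cmod (z j - z k))) \<le> Q * P (z j)"
  proof -
    have "{k. k \<noteq> j \<and> cmod (z j - z k) < 1} \<subseteq> {k. cmod (z k) \<le> cmod (z j) + 1}"
    proof
      fix k assume "k \<in> {k. k \<noteq> j \<and> cmod (z j - z k) < 1}"
      then show "k \<in> {k. cmod (z k) \<le> cmod (z j) + 1}"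
        using norm_triangle_ineq2[of "z k" "z j"] by (simp add: norm_minus_commute)
    qed
    then have "finite {k. k \<noteq> j \<and> cmod (z j - z k) < 1}" using finite_disc finite_subset by blast
    then have "(\<Sum>k\<in>S0. m k * ln (1 / cmod (z j - z k)))
        \<le> (\<Sum>k | k \<noteq> j \<and> cmod (z j - z k) < 1. m k * ln (1 / cmod (z j - z k)))"
    proof (rule sum_mono2)
      show "S0 \<subseteq> {k. k \<noteq> j \<and> cmod (z j - z k) < 1}" using S(2) by (auto simp: S0_def S1_def)
      fix k assume "k \<in> {k. k \<noteq> j \<and> cmod (z j - z k) < 1} - S0"
      then have "k \<noteq> j" "cmod (z j - z k) < 1" by auto
      moreover from this(1) have "z j \<noteq> z k" using inj_z by (auto dest: injD)
      ultimately show "0 \<le> m k * ln (1 / cmod (z j - z k))"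
        by (intro mult_nonneg_nonneg ln_ge_zero) auto
    qed
    also have "\<dots> \<le> Q * P (z j)" by (rule separation)
    finally show ?thesis .
  qed
  moreover have "(\<Sum>k\<in>S2. m k * exp (- lam * (cmod (z k) - cmod (z j)))) \<le> 2 * Q * K\<^sup>2 * P (z j)"
    using SS by (intro tail_le) (auto simp: S2_def)
  moreover have "(ln 16 * Q * K\<^sup>2 + Q + 12 * Q * K\<^sup>2) * P (z j)
      = ln 16 * (Q * K * (K * P (z j))) + Q * P (z j) + 6 * (2 * Q * K\<^sup>2 * P (z j))"
    by (simp add: algebra_simps power2_eq_square)
  ultimately have "(\<Sum>k\<in>S. real (m k) * f k) \<le> (ln 16 * Q * K\<^sup>2 + Q + 12 * Q * K\<^sup>2) * P (z j)"
    unfolding eq by linarith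
  then have "exp (- ((ln 16 * Q * K\<^sup>2 + Q + 12 * Q * K\<^sup>2) * P (z j))) \<le> exp (- (\<Sum>k\<in>S. real (m k) * f k))" by simp
  with * show ?thesis by linarith
qed

text \<open>
  The factors of \<open>h\<close> depend on \<open>j\<close>, through the choice of \<open>\<mu>\<close> in \<open>exp_factor_lower_near\<close>; the constants
  depend neither on \<open>j\<close> nor on \<open>S\<close>.
\<close>

lemma products_vanishing_off_one_point:
  obtains C r0 where "C \<ge> 0" "0 < r0" "r0 \<le> 1/2"
    "\<And>j S. finite S \<Longrightarrow> j \<notin> S \<Longrightarrow> \<exists>h. h holomorphic_on UNIV \<and> (\<forall>x. cmod (h x) \<le> exp (C * P x)) \<and>
       (\<forall>x. cmod (x - z j) \<le> r0 \<longrightarrow> (\<forall>k\<in>S. cmod (x - z j) \<le> cmod (z j - z k) / 2) \<longrightarrow>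
            exp (- C * P (z j)) \<le> cmod (h x)) \<and>
       (\<forall>k\<in>S. \<exists>q. q holomorphic_on UNIV \<and> (\<forall>x. h x = (x - z k) ^ m k * q x))"
proof
  define C1 where "C1 = 13 * lam * Q + Q * K + 2 * Q * K\<^sup>2"
  define C2 where "C2 = ln 16 * Q * K\<^sup>2 + Q + 12 * Q * K\<^sup>2"
  have C: "0 \<le> C1" "0 \<le> C2" unfolding C1_def C2_def using Q_nonneg K_ge_1 lam_ge_2 by auto
  show "0 \<le> C1 + C2" using C by simp
  show "0 < 1 / (13 * lam)" "1 / (13 * lam) \<le> 1/2" using lam_ge_2 by (auto simp: field_simps)
  fix j and S :: "nat set" assume S: "finite S" "j \<notin> S"
  have "\<exists>\<mu>. lam \<le> \<mu> \<and> \<mu> \<le> 13 * lam \<and> (\<forall>x. cmod (x - z j) \<le> 1 / (13 * lam) \<longrightarrow>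
      cmod (x - z j) \<le> cmod (z j - z k) / 2 \<longrightarrow> min 1 (cmod (z j - z k)) / 16 \<le> cmod (exp_factor (z k) \<mu> x))" for k
  proof -
    have "1 \<le> lam" using lam_ge_2 by simp
    from exp_factor_lower_near[OF this, of "z j" "z k"] show ?thesis by metis
  qed
  then have "\<forall>k. \<exists>\<mu>. lam \<le> \<mu> \<and> \<mu> \<le> 13 * lam \<and> (\<forall>x. cmod (x - z j) \<le> 1 / (13 * lam) \<longrightarrow>
      cmod (x - z j) \<le> cmod (z j - z k) / 2 \<longrightarrow> min 1 (cmod (z j - z k)) / 16 \<le> cmod (exp_factor (z k) \<mu> x))" ..
  from choice[OF this] obtain \<mu> where \<mu>: "\<forall>k. lam \<le> \<mu> k \<and> \<mu> k \<le> 13 * lam \<and> (\<forall>x. cmod (x - z j) \<le> 1 / (13 * lam) \<longrightarrow>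
      cmod (x - z j) \<le> cmod (z j - z k) / 2 \<longrightarrow> min 1 (cmod (z j - z k)) / 16 \<le> cmod (exp_factor (z k) (\<mu> k) x))" ..
  define h where "h x = (\<Prod>k\<in>S. exp_factor (z k) (\<mu> k) x ^ m k)" for x
  have "h holomorphic_on UNIV" unfolding h_def by (intro holomorphic_intros)
  moreover have "cmod (h x) \<le> exp ((C1 + C2) * P x)" for x
  proof -
    have "cmod (h x) \<le> exp (C1 * P x)" unfolding h_def C1_def using \<mu> by (intro product_upper S) auto
    also have "\<dots> \<le> exp ((C1 + C2) * P x)" using C P_pos[of x] by (simp add: mult_right_mono)
    finally show ?thesis .
  qed
  moreover have "exp (- (C1 + C2) * P (z j)) \<le> cmod (h x)"
    if "cmod (x - z j) \<le> 1 / (13 * lam)" "\<forall>k\<in>S. cmod (x - z j) \<le> cmod (z j - z k) / 2" for x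
  proof -
    have "exp (- (C1 + C2) * P (z j)) \<le> exp (- (C2 * P (z j)))"
      using mult_nonneg_nonneg[OF C(1), of "P (z j)"] P_pos[of "z j"] by (simp add: algebra_simps)
    also have "\<dots> \<le> cmod (h x)" unfolding h_def C2_def using \<mu> that S by (intro product_lower) auto
    finally show ?thesis .
  qed
  moreover have "\<exists>q. q holomorphic_on UNIV \<and> (\<forall>x. h x = (x - z k) ^ m k * q x)" if k: "k \<in> S" for k
  proof -
    obtain q where q: "q holomorphic_on UNIV" "\<And>x. exp_factor (z k) (\<mu> k) x - exp_factor (z k) (\<mu> k) (z k) = (x - z k) * q x"
      using holomorphic_factor_simple[OF exp_factor_holomorphic open_UNIV] by metis
    have "h x = (x - z k) ^ m k * (q x ^ m k * (\<Prod>i\<in>S - {k}. exp_factor (z i) (\<mu> i) x ^ m i))" for x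
      using q(2)[of x] unfolding h_def prod.remove[OF S(1) k] by (simp add: power_mult_distrib)
    moreover have "(\<lambda>x. q x ^ m k * (\<Prod>i\<in>S - {k}. exp_factor (z i) (\<mu> i) x ^ m i)) holomorphic_on UNIV"
      using q(1) by (intro holomorphic_intros)
    ultimately show ?thesis by (intro exI conjI allI)
  qed
  ultimately show "\<exists>h. h holomorphic_on UNIV \<and> (\<forall>x. cmod (h x) \<le> exp ((C1 + C2) * P x)) \<and>
       (\<forall>x. cmod (x - z j) \<le> 1 / (13 * lam) \<longrightarrow> (\<forall>k\<in>S. cmod (x - z j) \<le> cmod (z j - z k) / 2) \<longrightarrow>
            exp (- (C1 + C2) * P (z j)) \<le> cmod (h x)) \<and>
       (\<forall>k\<in>S. \<exists>q. q holomorphic_on UNIV \<and> (\<forall>x. h x = (x - z k) ^ m k * q x))"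
    by blast
qed

end

section \<open>Peak functions\<close>

lemma linear_ge_log:
  fixes a b :: real
  obtains D where "1 \<le> D" "a + b * ln D \<le> D"
proof
  \<comment> \<open>With \<open>D = s\<^sup>2\<close> the logarithm is at most \<open>2 s\<close>.\<close>
  define s where "s = \<bar>a\<bar> + 2 * \<bar>b\<bar> + 1"
  have s: "1 \<le> s" by (simp add: s_def)
  then have l: "0 \<le> ln (s\<^sup>2)" "ln (s\<^sup>2) \<le> 2 * s" using ln_le_minus_one[of s] by (auto simp: ln_realpow)
  show "1 \<le> s\<^sup>2" using s by simp
  have "b * ln (s\<^sup>2) \<le> \<bar>b\<bar> * (2 * s)" using l by (intro mult_mono) auto
  moreover have "\<bar>a\<bar> \<le> \<bar>a\<bar> * s" using mult_left_mono[OF s, of "\<bar>a\<bar>"] by simp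
  moreover have "s\<^sup>2 = \<bar>a\<bar> * s + \<bar>b\<bar> * (2 * s) + s"
    by (simp add: power2_eq_square s_def algebra_simps)
  ultimately show "a + b * ln (s\<^sup>2) \<le> s\<^sup>2" using s by linarith
qed

context sparse_points
begin

text \<open>
  For \<open>|a| \<ge> 1\<close> the peak at \<open>a\<close> is \<open>(x / a)^N\<close>, with \<open>N\<close> the first integer strictly above \<open>D \<beta>\<close>; so \<open>N\<close>
  is positive, and the peak vanishes at the origin. For \<open>|a| < 1\<close> the constant 1 will do. The rate in the lower bound does not depend
  on \<open>D\<close>, at the price of a disc of radius \<open>1 / (2 D)\<close>.
\<close>

lemma peak_functions:
  assumes D: "1 \<le> D"
  obtains C where "0 \<le> C"
    "\<And>a. \<exists>g. g holomorphic_on UNIV \<and> (\<forall>x. cmod (g x) \<le> exp (C * P x - D * P a)) \<and>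
      (\<forall>x. cmod (x - a) \<le> 1 / (2 * D) \<longrightarrow> exp (- (2 * K + 1) * P a) \<le> cmod (g x))"
proof
  define C where "C = D * P 1 + D + L"
  show "0 \<le> C" unfolding C_def using D P_pos[of 1] L_nonneg by simp
  fix a
  show "\<exists>g. g holomorphic_on UNIV \<and> (\<forall>x. cmod (g x) \<le> exp (C * P x - D * P a)) \<and>
      (\<forall>x. cmod (x - a) \<le> 1 / (2 * D) \<longrightarrow> exp (- (2 * K + 1) * P a) \<le> cmod (g x))"
  proof (cases "1 \<le> cmod a")
    case False
    have "D * P a \<le> C * P x" for x
    proof -
      have "D * P a \<le> D * P 1" using False D by (intro mult_left_mono P_mono) auto
      also have "\<dots> \<le> C * 1" unfolding C_def using D L_nonneg by simp
      also have "\<dots> \<le> C * P x" using \<open>0 \<le> C\<close> P_ge_1 by (intro mult_left_mono) auto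
      finally show ?thesis .
    qed
    moreover have "exp (- (2 * K + 1) * P a) \<le> 1" using K_ge_1 P_pos[of a] by (simp add: mult_nonpos_nonneg)
    ultimately show ?thesis by (intro exI[of _ "\<lambda>_. 1"]) auto
  next
    case True
    define r where "r = cmod a"
    have r: "1 \<le> r" using True by (simp add: r_def)
    obtain \<beta> where \<beta>: "0 \<le> \<beta>" "\<And>x. x \<noteq> 0 \<Longrightarrow> P a + \<beta> * ln (cmod x / r) \<le> P x"
      using P_slope[OF True] by (auto simp: r_def)
    define N where "N = nat \<lfloor>D * \<beta>\<rfloor> + 1"
    have "0 \<le> D * \<beta>" using D \<beta> by simp
    then have N: "D * \<beta> \<le> N" "N \<le> D * \<beta> + 1" unfolding N_def by linarith+
    define g where "g x = (x / a) ^ N" for x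
    have "cmod (g x) \<le> exp (C * P x - D * P a)" for x
    proof (cases "x = 0")
      case True
      then show ?thesis by (simp add: g_def N_def)
    next
      case x: False
      define t where "t = cmod x / r"
      have t: "0 < t" using x r by (simp add: t_def)
      have s: "D * (\<beta> * ln t) \<le> D * (P x - P a)"
        using \<beta>(2)[OF x] D by (intro mult_left_mono) (auto simp: t_def)
      have "N * ln t \<le> D * (\<beta> * ln t) + L * P x"
      proof (cases "t \<le> 1")
        case True
        then have "ln t \<le> 0" using t by simp
        then have "N * ln t \<le> (D * \<beta>) * ln t" using N(1) by (intro mult_right_mono_neg)
        moreover have "0 \<le> L * P x" using L_nonneg P_pos[of x] by simp
        ultimately show ?thesis by simp
      next
        case False
        have "N * ln t \<le> (D * \<beta> + 1) * ln t" using N(2) False by (intro mult_right_mono) auto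
        moreover have "ln t \<le> L * P x"
        proof -
          have "t \<le> cmod x" using r by (simp add: t_def divide_le_eq mult_le_cancel_left1)
          also have "\<dots> \<le> 1 + (cmod x)\<^sup>2"
          proof -
            have "0 \<le> (cmod x - 1)\<^sup>2" by simp
            also have "\<dots> = 1 + (cmod x)\<^sup>2 - 2 * cmod x" by (simp add: power2_eq_square algebra_simps)
            finally show ?thesis using norm_ge_zero[of x] by linarith
          qed
          also have "\<dots> \<le> exp (L * P x)" by (rule P_log)
          finally have "ln t \<le> ln (exp (L * P x))" using t by (subst ln_le_cancel_iff) auto
          then show ?thesis by simp
        qed
        ultimately show ?thesis by (simp add: algebra_simps)
      qed
      moreover have "0 \<le> D * P 1 * P x" using D P_pos[of 1] P_pos[of x] by simp
      ultimately have *: "N * ln t \<le> C * P x - D * P a"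
        using s by (simp add: C_def algebra_simps)
      have "cmod (g x) = t ^ N" by (simp add: g_def t_def r_def norm_power norm_divide)
      also have "\<dots> = exp (N * ln t)" using t by (simp add: exp_of_nat_mult)
      finally show ?thesis using * by simp
    qed
    moreover have "exp (- (2 * K + 1) * P a) \<le> cmod (g x)" if x: "cmod (x - a) \<le> 1 / (2 * D)" for x
    proof -
      \<comment> \<open>The supporting line, evaluated on the circle of radius \<open>r + 1\<close>, bounds its slope: \<open>\<beta> \<le> 2 r K P(a)\<close>.\<close>
      let ?y = "of_real (r + 1) :: complex"
      have y: "cmod ?y = r + 1" "?y \<noteq> 0" using r unfolding norm_of_real by (auto simp: of_real_eq_0_iff simp del: of_real_add)
      have "- ln ((r + 1) / r) = ln (r / (r + 1))" using r by (simp add: ln_div)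
      also have "\<dots> \<le> r / (r + 1) - 1" using r by (intro ln_le_minus_one) auto
      also have "\<dots> = - (1 / (r + 1))" using r by (simp add: field_simps)
      also have "\<dots> \<le> - (1 / (2 * r))" using r by (simp add: frac_le)
      finally have "1 / (2 * r) \<le> ln ((r + 1) / r)" by simp
      then have "\<beta> * (1 / (2 * r)) \<le> \<beta> * ln ((r + 1) / r)" using \<beta>(1) by (rule mult_left_mono)
      also have "\<dots> \<le> P ?y - P a" using \<beta>(2)[OF y(2)] unfolding y(1) by simp
      also have "\<dots> \<le> K * P a" using P_step[of ?y a] P_pos[of a] unfolding y(1) by (simp add: r_def)
      finally have br: "\<beta> / r \<le> 2 * K * P a" using r by (simp add: field_simps)
      define t where "t = 1 / (2 * D * r)"
      have Dr: "1 \<le> D * r" using D r mult_mono[of 1 D 1 r] by simp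
      then have t: "0 \<le> t" "t \<le> 1/2" by (auto simp: t_def field_simps)
      have "r - 1 / (2 * D) \<le> cmod x"
        using norm_triangle_ineq2[of a x] x by (simp add: r_def norm_minus_commute)
      then have "(r - 1 / (2 * D)) / r \<le> cmod x / r" using r by (intro divide_right_mono) auto
      moreover have "(r - 1 / (2 * D)) / r = 1 - t" using r by (simp add: t_def diff_divide_distrib)
      ultimately have "exp (- 2 * t) \<le> cmod x / r" using one_minus_ge_exp[OF t] by simp
      then have "exp (- 2 * t) ^ N \<le> (cmod x / r) ^ N" by (intro power_mono) auto
      also have "\<dots> = cmod (g x)" by (simp add: g_def r_def norm_power norm_divide)
      also have "exp (- 2 * t) ^ N = exp (- (2 * t * N))" by (simp add: exp_of_nat_mult[symmetric] mult.commute)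
      finally have 1: "exp (- (2 * t * N)) \<le> cmod (g x)" .
      have "2 * t * N \<le> 2 * t * (D * \<beta> + 1)" using N(2) t by (intro mult_left_mono) auto
      also have "\<dots> = \<beta> / r + 2 * t" using D r by (simp add: t_def field_simps)
      also have "\<dots> \<le> 2 * K * P a + 1 * P a" using br t P_ge_1[of a] by (intro add_mono) auto
      finally have "exp (- (2 * K + 1) * P a) \<le> exp (- (2 * t * N))" by (simp add: algebra_simps)
      with 1 show ?thesis by linarith
    qed
    moreover have "g holomorphic_on UNIV" unfolding g_def using r
      by (intro holomorphic_intros) (auto simp: r_def)
    ultimately show ?thesis by blast
  qed
qed

text \<open>
  The condition \<open>separation\<close> at \<open>z\<^sub>k\<close> bounds the multiplicity of \<open>z\<^sub>j\<close>; since the two nodes are close, \<open>P\<close> is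
  comparable at both.
\<close>

lemma separation_pair:
  assumes "k \<noteq> j" "cmod (z j - z k) < 1"
  shows "m j * ln (1 / cmod (z j - z k)) \<le> Q * K * P (z j)"
proof -
  have fin: "finite {i. i \<noteq> k \<and> cmod (z k - z i) < 1}"
  proof (rule finite_subset[OF _ finite_disc[of "cmod (z k) + 1"]], rule subsetI)
    fix i assume "i \<in> {i. i \<noteq> k \<and> cmod (z k - z i) < 1}"
    then show "i \<in> {i. cmod (z i) \<le> cmod (z k) + 1}"
      using norm_triangle_ineq2[of "z i" "z k"] by (simp add: norm_minus_commute)
  qed
  have pos: "0 \<le> m i * ln (1 / cmod (z k - z i))" if "i \<in> {i. i \<noteq> k \<and> cmod (z k - z i) < 1}" for i
  proof -
    have "z k \<noteq> z i" using that inj_z by (auto dest: injD)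
    then show ?thesis using that by (intro mult_nonneg_nonneg ln_ge_zero) auto
  qed
  have "m j * ln (1 / cmod (z k - z j)) \<le> (\<Sum>i | i \<noteq> k \<and> cmod (z k - z i) < 1. m i * ln (1 / cmod (z k - z i)))"
    using assms by (intro member_le_sum[OF _ pos fin]) (auto simp: norm_minus_commute)
  also have "\<dots> \<le> Q * P (z k)" by (rule separation)
  also have "\<dots> \<le> Q * (K * P (z j))"
    using assms(2) norm_triangle_ineq2[of "z k" "z j"] Q_nonneg
    by (intro mult_left_mono P_step) (auto simp: norm_minus_commute)
  finally show ?thesis by (simp add: norm_minus_commute mult.assoc)
qed

text \<open>
  The \<open>m\<^sub>j\<close>-th power of this radius is \<open>c^m\<^sub>j exp (- Q K P(z\<^sub>j))\<close>, and still the disc stays away from all other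
  nodes.
\<close>

definition node_radius :: "real \<Rightarrow> nat \<Rightarrow> real" where
  "node_radius c j = c * exp (- (Q * K * P (z j) / m j))"

lemma node_radius:
  assumes "0 < c" "c \<le> 1/2"
  shows "0 < node_radius c j" "node_radius c j \<le> c"
    "k \<noteq> j \<Longrightarrow> node_radius c j \<le> cmod (z j - z k) / 2"
    "m j * ln (32 / node_radius c j) \<le> Q * K * (ln (32 / c) + 1) * P (z j)"
proof -
  let ?e = "Q * K * P (z j) / m j"
  have e: "0 \<le> ?e" using Q_nonneg K_ge_1 P_pos[of "z j"] by simp
  show pos: "0 < node_radius c j" using assms by (simp add: node_radius_def)
  have "c * exp (- ?e) \<le> c * 1" using assms e by (intro mult_left_mono) auto
  then show le: "node_radius c j \<le> c" by (simp add: node_radius_def)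
  show "node_radius c j \<le> cmod (z j - z k) / 2" if k: "k \<noteq> j"
  proof (cases "cmod (z j - z k) < 1")
    case False
    then show ?thesis using le assms by simp
  next
    case True
    have ne: "0 < cmod (z j - z k)" using k inj_z by (auto dest: injD)
    have "- ?e \<le> - ln (1 / cmod (z j - z k))"
      using separation_pair[OF k True] m_pos[of j] by (simp add: field_simps)
    also have "\<dots> = ln (cmod (z j - z k))" using ne by (simp add: ln_div)
    finally have "exp (- ?e) \<le> exp (ln (cmod (z j - z k)))" by (simp only: exp_le_cancel_iff)
    then have "exp (- ?e) \<le> cmod (z j - z k)" using ne by (simp only: exp_ln)
    then have "c * exp (- ?e) \<le> 1/2 * cmod (z j - z k)" using assms by (intro mult_mono) auto
    then show ?thesis by (simp add: node_radius_def)
  qed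
  have l: "0 \<le> ln (32 / c)" using assms by (intro ln_ge_zero) (simp add: field_simps)
  have "32 / node_radius c j = 32 / c * exp ?e" by (simp add: node_radius_def exp_minus field_simps)
  moreover have "ln (32 / c * exp ?e) = ln (32 / c) + ln (exp ?e)" using assms by (simp only: ln_mult) auto
  ultimately have "ln (32 / node_radius c j) = ln (32 / c) + ?e" by (simp only: ln_exp)
  then have "m j * ln (32 / node_radius c j) = m j * ln (32 / c) + Q * K * P (z j)"
    using m_pos[of j] by (simp add: algebra_simps)
  also have "\<dots> \<le> Q * K * P (z j) * ln (32 / c) + Q * K * P (z j)"
    using m_le[of j] l by (intro add_mono mult_right_mono order_refl)
  finally show "m j * ln (32 / node_radius c j) \<le> Q * K * (ln (32 / c) + 1) * P (z j)"
    by (simp add: algebra_simps)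
qed

text \<open>
  The reason for using \<open>exp_factor\<close> as a coordinate: on the circle about the origin through
  \<open>z\<^sub>j\<close>, the power \<open>(x - z\<^sub>j)^l\<close> may be as large as \<open>(2 |z\<^sub>j|)^l\<close>, and \<open>m\<^sub>j ln |z\<^sub>j|\<close> need not be
  \<open>O(P(z\<^sub>j))\<close>.
\<close>

lemma exp_factor_coordinate_power_le:
  assumes "l \<le> m j"
  shows "cmod (exp_factor (z j) 1 x) ^ l \<le> exp (Q * P x + Q * K * P (z j))"
proof -
  define y where "y = max 0 (cmod x - cmod (z j))"
  have "cmod (exp_factor (z j) 1 x) \<le> exp (y + 1)"
    using exp_factor_upper_outside[of 1 1 "z j" x] exp_factor_upper_inside[of 0 1 x "z j"]
    by (cases "cmod x \<le> cmod (z j)") (auto simp: y_def)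
  then have "cmod (exp_factor (z j) 1 x) ^ l \<le> exp (y + 1) ^ l" by (intro power_mono) auto
  also have "\<dots> \<le> exp (y + 1) ^ m j" using assms by (intro power_increasing) (auto simp: y_def)
  also have "\<dots> = exp (m j * y + m j)" by (simp add: exp_of_nat_mult[symmetric] algebra_simps)
  also have "m j * y \<le> Q * P x"
  proof (cases "cmod (z j) \<le> cmod x")
    case True
    then show ?thesis using weighted_count_le[of "{j}" x] by (simp add: y_def)
  next
    case False
    then show ?thesis using Q_nonneg P_pos[of x] by (simp add: y_def)
  qed
  then have "exp (m j * y + m j) \<le> exp (Q * P x + Q * K * P (z j))" using m_le[of j] by simp
  finally show ?thesis .
qed

lemma exp_factor_coordinate:
  "exp_factor a 1 a = 0" "deriv (exp_factor a 1) a \<noteq> 0"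
  "cmod (x - a) \<le> 1 \<Longrightarrow> cmod (x - a) / 8 \<le> cmod (exp_factor a 1 x)"
proof -
  have "(exp_factor a 1 has_field_derivative - cnj (dir a)) (at a)"
    unfolding exp_factor_def by (auto intro!: derivative_eq_intros)
  then have "deriv (exp_factor a 1) a = - cnj (dir a)" by (rule DERIV_imp_deriv)
  moreover have "dir a \<noteq> 0" using norm_dir[of a] by (metis norm_zero zero_neq_one)
  ultimately show "deriv (exp_factor a 1) a \<noteq> 0" by simp
  assume x: "cmod (x - a) \<le> 1"
  let ?y = "cnj (dir a) * (x - a)"
  have n: "cmod ?y = cmod (x - a)" by (simp add: norm_mult)
  have "min 1 (cmod ?y) / 8 \<le> cmod (1 - exp ?y)"
    using abs_Im_le_cmod[of ?y] x by (intro norm_one_minus_exp_lower_near_0) (simp only: n)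
  then show "cmod (x - a) / 8 \<le> cmod (exp_factor a 1 x)" using x n by (simp add: exp_factor_def)
qed simp

end

section \<open>Interpolation\<close>

context sparse_points
begin

text \<open>
  The coefficients \<open>c\<close> come from the expansion of the data polynomial divided by \<open>H\<close>. Multiplying back by \<open>H\<close>
  leaves an error which is divisible by the \<open>m\<^sub>j\<close>-th power of the coordinate.
\<close>

lemma jet_transfer:
  assumes a: "0 < R" "R \<le> 1" and H: "H holomorphic_on UNIV" "\<And>x. cmod (x - z j) \<le> R \<Longrightarrow> \<eta> \<le> cmod (H x)" "0 < \<eta>"
    and M: "(\<Sum>l<m j. cmod (w l)) \<le> M"
  obtains c where "\<And>l. l < m j \<Longrightarrow> cmod (c l) \<le> M / \<eta> * (32 / R) ^ m j"
    "\<And>l. l < m j \<Longrightarrow> (deriv ^^ l) (\<lambda>x. H x * (\<Sum>i<m j. c i * exp_factor (z j) 1 x ^ i)) (z j) = fact l * w l"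
proof -
  define a where "a = z j"
  define p where "p x = (\<Sum>l<m j. w l * (x - a) ^ l)" for x
  define g where "g x = p x / H x" for x
  have ball: "cmod (x - a) \<le> R" if "x \<in> ball a R" for x
    using that by (simp add: dist_norm norm_minus_commute)
  have H0: "H x \<noteq> 0" if "cmod (x - a) \<le> R" for x using H(2)[of x] H(3) that by (auto simp: a_def)
  have gM: "cmod (g x) \<le> M / \<eta>" if x: "cmod (x - a) \<le> R / 2" for x
  proof -
    have "cmod (p x) \<le> (\<Sum>l<m j. cmod (w l) * cmod (x - a) ^ l)"
      unfolding p_def by (rule order_trans[OF norm_sum]) (simp add: norm_mult norm_power)
    also have "\<dots> \<le> (\<Sum>l<m j. cmod (w l) * 1)"
      using x assms(1,2) by (intro sum_mono mult_left_mono power_le_one) auto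
    also have "\<dots> \<le> M" using M by simp
    finally have "cmod (p x) \<le> M" .
    moreover have "\<eta> \<le> cmod (H x)" using H(2)[of x] x assms(1) by (simp add: a_def)
    moreover have "0 \<le> M" using M by (rule order_trans[rotated]) (simp add: sum_nonneg)
    ultimately show ?thesis using H(3) unfolding g_def norm_divide by (intro frac_le) auto
  qed
  \<comment> \<open>On the circle of radius \<open>R / 2\<close> the coordinate has modulus at least \<open>R / 16\<close>.\<close>
  have "\<exists>c r. r holomorphic_on ball a R \<and>
      (\<forall>x\<in>ball a R. g x = (\<Sum>l<m j. c l * exp_factor a 1 x ^ l) + exp_factor a 1 x ^ m j * r x) \<and>
      (\<forall>l<m j. cmod (c l) \<le> M / \<eta> * (2 / (R / 16)) ^ l) \<and>
      (\<forall>x. cmod (x - a) \<le> R / 2 \<longrightarrow> cmod (r x) \<le> M / \<eta> * (2 / (R / 16)) ^ m j)"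
  proof (rule expansion_in_local_coordinate)
    show "g holomorphic_on ball a R" unfolding g_def p_def
      using H0 ball by (intro holomorphic_intros holomorphic_on_subset[OF H(1)]) auto
    show "exp_factor a 1 x \<noteq> 0" if "x \<in> ball a R" "x \<noteq> a" for x
    proof -
      have "0 < cmod (x - a) / 8" using that by simp
      also have "\<dots> \<le> cmod (exp_factor a 1 x)" using ball[OF that(1)] assms(2) by (intro exp_factor_coordinate(3)) auto
      finally show ?thesis by auto
    qed
    show "R / 16 \<le> cmod (exp_factor a 1 x)" if "cmod (x - a) = R / 2" for x
      using exp_factor_coordinate(3)[of x a] that assms(1,2) by simp
  qed (use assms(1,2) exp_factor_coordinate gM in \<open>auto intro: holomorphic_intros\<close>)
  then obtain c r where cr: "r holomorphic_on ball a R \<and>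
      (\<forall>x\<in>ball a R. g x = (\<Sum>l<m j. c l * exp_factor a 1 x ^ l) + exp_factor a 1 x ^ m j * r x) \<and>
      (\<forall>l<m j. cmod (c l) \<le> M / \<eta> * (2 / (R / 16)) ^ l) \<and>
      (\<forall>x. cmod (x - a) \<le> R / 2 \<longrightarrow> cmod (r x) \<le> M / \<eta> * (2 / (R / 16)) ^ m j)"
    by (elim exE) (rule that)
  have Me: "0 \<le> M / \<eta>" using gM[of a] assms(1) by (intro order_trans[OF norm_ge_zero]) auto
  have c: "cmod (c l) \<le> M / \<eta> * (32 / R) ^ m j" if l: "l < m j" for l
  proof -
    have "cmod (c l) \<le> M / \<eta> * (32 / R) ^ l" using cr l by simp
    also have "\<dots> \<le> M / \<eta> * (32 / R) ^ m j"
      using Me l assms(1,2) by (intro mult_left_mono power_increasing) auto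
    finally show ?thesis .
  qed
  obtain v where v: "v holomorphic_on UNIV" "\<And>x. exp_factor a 1 x - exp_factor a 1 a = (x - a) * v x"
    using holomorphic_factor_simple[OF exp_factor_holomorphic open_UNIV] by metis
  have jets: "(deriv ^^ l) (\<lambda>x. H x * (\<Sum>i<m j. c i * exp_factor a 1 x ^ i)) a = fact l * w l" if l: "l < m j" for l
  proof -
    have "(deriv ^^ l) (\<lambda>x. H x * (\<Sum>i<m j. c i * exp_factor a 1 x ^ i)) a = (deriv ^^ l) p a"
    proof (rule higher_deriv_eq_if_diff_factor[OF _ _ _ open_ball _ l])
      show "(\<lambda>x. H x * (\<Sum>i<m j. c i * exp_factor a 1 x ^ i)) holomorphic_on ball a R"
        by (intro holomorphic_intros holomorphic_on_subset[OF H(1)]) auto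
      show "p holomorphic_on ball a R" unfolding p_def by (intro holomorphic_intros)
      show "(\<lambda>x. - (H x * v x ^ m j * r x)) holomorphic_on ball a R"
        using cr by (intro holomorphic_intros holomorphic_on_subset[OF H(1)] holomorphic_on_subset[OF v(1)]) auto
      show "a \<in> ball a R" using assms(1) by simp
      fix x assume x: "x \<in> ball a R"
      have "p x = H x * g x" using H0[OF ball[OF x]] by (simp add: g_def)
      also have "g x = (\<Sum>l<m j. c l * exp_factor a 1 x ^ l) + exp_factor a 1 x ^ m j * r x" using cr x by blast
      also have "exp_factor a 1 x ^ m j = (x - a) ^ m j * v x ^ m j" using v(2)[of x] by (simp add: power_mult_distrib)
      finally show "H x * (\<Sum>i<m j. c i * exp_factor a 1 x ^ i) - p x = (x - a) ^ m j * - (H x * v x ^ m j * r x)"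
        by (simp add: algebra_simps)
    qed
    also have "\<dots> = fact l * w l"
      using higher_deriv_taylor_polynomial[where l = l and n = "m j" and w = w and a = a] l
      by (simp add: p_def[abs_def])
    finally show ?thesis .
  qed
  from c jets show ?thesis unfolding a_def by (rule that)
qed

text \<open>
  The peak parameter \<open>D\<close> is chosen after the products, and the disc on which the jet is transferred after
  \<open>D\<close>. The disc costs \<open>Q K ln D\<close> in the exponent and the peak gains \<open>D\<close>.
\<close>

lemma node_functions:
  assumes "0 < A"
  obtains C where "0 \<le> C"
    "\<And>j S w. finite S \<Longrightarrow> j \<notin> S \<Longrightarrow> (\<Sum>l<m j. cmod (w l)) \<le> A * exp (B * P (z j)) \<Longrightarrow>
      \<exists>f. f holomorphic_on UNIV \<and> (\<forall>x. cmod (f x) \<le> A * exp (C * P x) * exp (- (L + 1) * P (z j))) \<and>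
        (\<forall>l<m j. (deriv ^^ l) f (z j) = fact l * w l) \<and> (\<forall>k\<in>S. \<forall>l<m k. (deriv ^^ l) f (z k) = 0)"
proof -
  obtain Ch r0 where Ch: "0 \<le> Ch" "0 < r0" "r0 \<le> 1/2"
    "\<And>j S. finite S \<Longrightarrow> j \<notin> S \<Longrightarrow> \<exists>h. h holomorphic_on UNIV \<and> (\<forall>x. cmod (h x) \<le> exp (Ch * P x)) \<and>
       (\<forall>x. cmod (x - z j) \<le> r0 \<longrightarrow> (\<forall>k\<in>S. cmod (x - z j) \<le> cmod (z j - z k) / 2) \<longrightarrow>
            exp (- Ch * P (z j)) \<le> cmod (h x)) \<and>
       (\<forall>k\<in>S. \<exists>q. q holomorphic_on UNIV \<and> (\<forall>x. h x = (x - z k) ^ m k * q x))"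
    using products_vanishing_off_one_point by blast
  obtain D where D: "1 \<le> D"
    "(L + 1 + B + Ch + (2 * K + 1) + Q * K * (ln (32 / r0) + 3)) + Q * K * ln D \<le> D"
    by (rule linear_ge_log)
  obtain Cg where Cg: "0 \<le> Cg"
    "\<And>a. \<exists>g. g holomorphic_on UNIV \<and> (\<forall>x. cmod (g x) \<le> exp (Cg * P x - D * P a)) \<and>
      (\<forall>x. cmod (x - a) \<le> 1 / (2 * D) \<longrightarrow> exp (- (2 * K + 1) * P a) \<le> cmod (g x))"
    using peak_functions[OF D(1)] by blast
  show ?thesis
  proof
    show "0 \<le> Ch + Cg + Q" using Ch(1) Cg(1) Q_nonneg by simp
    fix j S and w :: "nat \<Rightarrow> complex"
    assume S: "finite S" "j \<notin> S" and w: "(\<Sum>l<m j. cmod (w l)) \<le> A * exp (B * P (z j))"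
    define a where "a = z j"
    define c where "c = r0 / D"
    define R where "R = node_radius c j"
    have c: "0 < c" "c \<le> 1/2" "c \<le> r0" "c \<le> 1 / (2 * D)"
      using Ch(2,3) D(1) mult_mono[OF Ch(3) D(1)] by (auto simp: c_def field_simps)
    note R = node_radius[OF c(1,2), where j = j, folded R_def]
    from Ch(4)[OF S] obtain h where h: "h holomorphic_on UNIV" "\<And>x. cmod (h x) \<le> exp (Ch * P x)"
      "\<And>x. cmod (x - z j) \<le> r0 \<Longrightarrow> \<forall>k\<in>S. cmod (x - z j) \<le> cmod (z j - z k) / 2 \<Longrightarrow> exp (- Ch * P (z j)) \<le> cmod (h x)"
      "\<And>k. k \<in> S \<Longrightarrow> \<exists>q. q holomorphic_on UNIV \<and> (\<forall>x. h x = (x - z k) ^ m k * q x)" by (elim exE conjE) auto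
    from Cg(2)[of a] obtain g where g: "g holomorphic_on UNIV" "\<And>x. cmod (g x) \<le> exp (Cg * P x - D * P a)"
      "\<And>x. cmod (x - a) \<le> 1 / (2 * D) \<Longrightarrow> exp (- (2 * K + 1) * P a) \<le> cmod (g x)" by (elim exE conjE) auto
    define H where "H x = h x * g x" for x
    define \<eta> where "\<eta> = exp (- Ch * P a) * exp (- (2 * K + 1) * P a)"
    have H: "H holomorphic_on UNIV" unfolding H_def using h(1) g(1) by (intro holomorphic_intros)
    have eta: "\<eta> \<le> cmod (H x)" if x: "cmod (x - z j) \<le> R" for x
    proof -
      have "\<forall>k\<in>S. cmod (x - z j) \<le> cmod (z j - z k) / 2"
      proof
        fix k assume "k \<in> S"
        then have "k \<noteq> j" using S(2) by auto
        from R(3)[OF this] x show "cmod (x - z j) \<le> cmod (z j - z k) / 2" by linarith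
      qed
      then have "exp (- Ch * P a) \<le> cmod (h x)" using h(3) x R(2) c(3) by (simp add: a_def)
      moreover have "exp (- (2 * K + 1) * P a) \<le> cmod (g x)" using x R(2) c(4) by (intro g(3)) (simp add: a_def)
      ultimately show ?thesis unfolding \<eta>_def H_def norm_mult by (intro mult_mono) auto
    qed
    have R1: "R \<le> 1" using R(2) c(2) by simp
    have "0 < \<eta>" by (simp add: \<eta>_def)
    obtain b where b: "\<And>l. l < m j \<Longrightarrow> cmod (b l) \<le> A * exp (B * P (z j)) / \<eta> * (32 / R) ^ m j"
      "\<And>l. l < m j \<Longrightarrow> (deriv ^^ l) (\<lambda>x. H x * (\<Sum>i<m j. b i * exp_factor (z j) 1 x ^ i)) (z j) = fact l * w l"
      using jet_transfer[OF R(1) R1 H eta \<open>0 < \<eta>\<close> w] by blast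
    define f where "f x = H x * (\<Sum>i<m j. b i * exp_factor (z j) 1 x ^ i)" for x
    have "f holomorphic_on UNIV" unfolding f_def using H by (intro holomorphic_intros)
    moreover have "cmod (f x) \<le> A * exp ((Ch + Cg + Q) * P x) * exp (- (L + 1) * P (z j))" for x
    proof -
      define M where "M = A * exp (B * P a + (Ch + 2 * K + 1) * P a + Q * K * (ln (32 / c) + 1) * P a)"
      have bM: "cmod (b l) \<le> M" if "l < m j" for l
      proof -
        have "(32 / R) ^ m j = exp (m j * ln (32 / R))" using R(1) by (simp add: exp_of_nat_mult)
        also have "\<dots> \<le> exp (Q * K * (ln (32 / c) + 1) * P a)" using R(4) by (simp add: a_def)
        finally have "A * exp (B * P a) / \<eta> * (32 / R) ^ m j \<le> A * exp (B * P a) / \<eta> * exp (Q * K * (ln (32 / c) + 1) * P a)"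
          using assms \<open>0 < \<eta>\<close> by (intro mult_left_mono) auto
        also have "\<dots> = M" unfolding M_def \<eta>_def
          by (simp add: exp_add[symmetric] exp_diff[symmetric] times_divide_eq_right[symmetric] del: times_divide_eq_right)
             (simp add: algebra_simps)
        finally show ?thesis using b(1)[OF that] by (simp add: a_def)
      qed
      have "cmod (\<Sum>i<m j. b i * exp_factor (z j) 1 x ^ i) \<le> (\<Sum>i<m j. M * exp (Q * P x + Q * K * P a))"
      proof (rule order_trans[OF norm_sum], rule sum_mono)
        fix i assume "i \<in> {..<m j}"
        then have i: "i < m j" by simp
        show "cmod (b i * exp_factor (z j) 1 x ^ i) \<le> M * exp (Q * P x + Q * K * P a)"
          unfolding norm_mult norm_power a_def
          using bM[OF i] i order_trans[OF norm_ge_zero bM[OF i]]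
          by (intro mult_mono exp_factor_coordinate_power_le) auto
      qed
      also have "\<dots> = real (m j) * (M * exp (Q * P x + Q * K * P a))" by simp
      also have "\<dots> \<le> exp (Q * K * P a) * (M * exp (Q * P x + Q * K * P a))"
      proof (rule mult_right_mono)
        have "real (m j) \<le> exp (real (m j))" using exp_ge_add_one_self[of "real (m j)"] by linarith
        also have "\<dots> \<le> exp (Q * K * P a)" using m_le[of j] by (simp add: a_def)
        finally show "real (m j) \<le> exp (Q * K * P a)" .
        show "0 \<le> M * exp (Q * P x + Q * K * P a)" using assms by (simp add: M_def)
      qed
      finally have G: "cmod (\<Sum>i<m j. b i * exp_factor (z j) 1 x ^ i) \<le> exp (Q * K * P a) * (M * exp (Q * P x + Q * K * P a))" .
      have "cmod (f x) = cmod (h x) * cmod (g x) * cmod (\<Sum>i<m j. b i * exp_factor (z j) 1 x ^ i)"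
        by (simp add: f_def H_def norm_mult)
      also have "\<dots> \<le> exp (Ch * P x) * exp (Cg * P x - D * P a) * (exp (Q * K * P a) * (M * exp (Q * P x + Q * K * P a)))"
        using h(2) g(2) G by (intro mult_mono) auto
      also have "\<dots> = A * (exp (Ch * P x) * exp (Cg * P x - D * P a) * exp (Q * K * P a) * exp (Q * P x + Q * K * P a)
          * exp (B * P a + (Ch + 2 * K + 1) * P a + Q * K * (ln (32 / c) + 1) * P a))"
        by (simp only: M_def ac_simps)
      also have "\<dots> = A * exp ((Ch + Cg + Q) * P x + (B + Ch + (2 * K + 1) + Q * K * (ln (32 / c) + 3) - D) * P a)"
        unfolding exp_add[symmetric] by (rule arg_cong[of _ _ "\<lambda>t. A * exp t"]) (simp add: algebra_simps)
      also have "\<dots> \<le> A * exp ((Ch + Cg + Q) * P x + (- (L + 1)) * P a)"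
      proof -
        have "32 / c = 32 / r0 * D" by (simp add: c_def)
        then have "ln (32 / c) = ln (32 / r0) + ln D" using Ch(2) D(1) by (simp only: ln_mult) auto
        then have "B + Ch + (2 * K + 1) + Q * K * (ln (32 / c) + 3) - D \<le> - (L + 1)"
          using D(2) by (simp add: algebra_simps)
        then show ?thesis using assms P_pos[of a] by (intro mult_left_mono) (auto intro: mult_right_mono)
      qed
      finally show ?thesis by (simp only: exp_add a_def mult.assoc)
    qed
    moreover have "(deriv ^^ l) f (z k) = 0" if k: "k \<in> S" "l < m k" for k l
    proof -
      obtain q where q: "q holomorphic_on UNIV" "\<And>x. h x = (x - z k) ^ m k * q x" using h(4)[OF k(1)] by auto
      have "f = (\<lambda>x. (x - z k) ^ m k * (q x * g x * (\<Sum>i<m j. b i * exp_factor (z j) 1 x ^ i)))"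
        by (rule ext) (simp add: f_def H_def q(2) mult.assoc)
      moreover have "(\<lambda>x. q x * g x * (\<Sum>i<m j. b i * exp_factor (z j) 1 x ^ i)) holomorphic_on UNIV"
        using q(1) g(1) by (intro holomorphic_intros)
      ultimately show ?thesis using k(2) by (simp add: higher_deriv_eq_0_if_factor[OF _ open_UNIV])
    qed
    moreover have "(deriv ^^ l) f (z j) = fact l * w l" if "l < m j" for l
      using b(2)[OF that] unfolding f_def .
    ultimately show "\<exists>f. f holomorphic_on UNIV \<and> (\<forall>x. cmod (f x) \<le> A * exp ((Ch + Cg + Q) * P x) * exp (- (L + 1) * P (z j))) \<and>
        (\<forall>l<m j. (deriv ^^ l) f (z j) = fact l * w l) \<and> (\<forall>k\<in>S. \<forall>l<m k. (deriv ^^ l) f (z k) = 0)"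
      by blast
  qed
qed

text \<open>
  Adding the node functions of the first \<open>n\<close> nodes, each vanishing at the other \<open>n - 1\<close> nodes, gives functions
  which are locally bounded uniformly in \<open>n\<close>. Jets pass to the locally uniform limit of a subsequence.
\<close>

theorem interpolation:
  assumes A: "0 < A" and w: "\<And>j. (\<Sum>l<m j. cmod (w j l)) \<le> A * exp (B * P (z j))"
  obtains f C M where "f holomorphic_on UNIV" "0 \<le> C" "\<And>x. cmod (f x) \<le> M * exp (C * P x)"
    "\<And>j l. l < m j \<Longrightarrow> (deriv ^^ l) f (z j) = fact l * w j l"
proof -
  obtain C where C: "0 \<le> C"
    "\<And>j S w. finite S \<Longrightarrow> j \<notin> S \<Longrightarrow> (\<Sum>l<m j. cmod (w l)) \<le> A * exp (B * P (z j)) \<Longrightarrow>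
      \<exists>f. f holomorphic_on UNIV \<and> (\<forall>x. cmod (f x) \<le> A * exp (C * P x) * exp (- (L + 1) * P (z j))) \<and>
        (\<forall>l<m j. (deriv ^^ l) f (z j) = fact l * w l) \<and> (\<forall>k\<in>S. \<forall>l<m k. (deriv ^^ l) f (z k) = 0)"
    using node_functions[OF A, of B] by blast
  obtain T where T: "T \<ge> 0" "\<And>S. finite S \<Longrightarrow> (\<Sum>j\<in>S. exp (- (L + 1) * P (z j))) \<le> T"
    using sum_exp_P_bounded by blast
  have "\<exists>F. F holomorphic_on UNIV \<and> (\<forall>x. cmod (F x) \<le> A * T * exp (C * P x)) \<and>
     (\<forall>j<n. \<forall>l<m j. (deriv ^^ l) F (z j) = fact l * w j l)" for n
  proof -
    have "\<forall>j. \<exists>f. f holomorphic_on UNIV \<and> (\<forall>x. cmod (f x) \<le> A * exp (C * P x) * exp (- (L + 1) * P (z j))) \<and>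
        (\<forall>l<m j. (deriv ^^ l) f (z j) = fact l * w j l) \<and> (\<forall>k\<in>{..<n}-{j}. \<forall>l<m k. (deriv ^^ l) f (z k) = 0)"
      using w by (intro allI C(2)) auto
    from choice[OF this] obtain f where f: "\<forall>j. f j holomorphic_on UNIV \<and>
        (\<forall>x. cmod (f j x) \<le> A * exp (C * P x) * exp (- (L + 1) * P (z j))) \<and>
        (\<forall>l<m j. (deriv ^^ l) (f j) (z j) = fact l * w j l) \<and>
        (\<forall>k\<in>{..<n}-{j}. \<forall>l<m k. (deriv ^^ l) (f j) (z k) = 0)" ..
    define F where "F x = (\<Sum>j<n. f j x)" for x
    have "F holomorphic_on UNIV" unfolding F_def using f by (intro holomorphic_intros) auto
    moreover have "cmod (F x) \<le> A * T * exp (C * P x)" for x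
    proof -
      have "cmod (F x) \<le> (\<Sum>j<n. A * exp (C * P x) * exp (- (L + 1) * P (z j)))"
        unfolding F_def using f by (intro order_trans[OF norm_sum] sum_mono) auto
      also have "\<dots> = A * exp (C * P x) * (\<Sum>j<n. exp (- (L + 1) * P (z j)))" by (simp only: sum_distrib_left)
      also have "\<dots> \<le> A * exp (C * P x) * T" using A by (intro mult_left_mono T) auto
      finally show ?thesis by (simp add: ac_simps)
    qed
    moreover have "(deriv ^^ l) F (z j) = fact l * w j l" if j: "j < n" "l < m j" for j l
    proof -
      have "(deriv ^^ l) F (z j) = (\<Sum>i<n. (deriv ^^ l) (f i) (z j))"
        unfolding F_def using f by (intro higher_deriv_sum[of _ _ UNIV]) auto
      also have "\<dots> = (\<Sum>i<n. if i = j then fact l * w j l else 0)"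
        using f j by (intro sum.cong) auto
      finally show ?thesis using j by simp
    qed
    ultimately show ?thesis by blast
  qed
  then have "\<forall>n. \<exists>F. F holomorphic_on UNIV \<and> (\<forall>x. cmod (F x) \<le> A * T * exp (C * P x)) \<and>
     (\<forall>j<n. \<forall>l<m j. (deriv ^^ l) F (z j) = fact l * w j l)" ..
  from choice[OF this] obtain F where F: "\<forall>n. F n holomorphic_on UNIV \<and>
     (\<forall>x. cmod (F n x) \<le> A * T * exp (C * P x)) \<and>
     (\<forall>j<n. \<forall>l<m j. (deriv ^^ l) (F n) (z j) = fact l * w j l)" ..
  have loc_bound: "\<exists>b. \<forall>h\<in>range F. \<forall>x\<in>X. cmod (h x) \<le> b" if X: "compact X" for X
  proof -
    obtain b where b: "b > 0" "\<And>x. x \<in> X \<Longrightarrow> cmod x \<le> b"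
      using compact_imp_bounded[OF X] bounded_pos by metis
    have "cmod (F n x) \<le> A * T * exp (C * P (of_real b))" if "x \<in> X" for n x
    proof -
      have "cmod (F n x) \<le> A * T * exp (C * P x)" using F by simp
      also have "\<dots> \<le> A * T * exp (C * P (of_real b))"
        using A T(1) C(1) b that by (intro mult_left_mono) (auto intro!: mult_left_mono P_mono)
      finally show ?thesis .
    qed
    then show ?thesis by blast
  qed
  obtain f \<rho> where f: "f holomorphic_on UNIV" "strict_mono (\<rho> :: nat \<Rightarrow> nat)"
    "\<And>x. x \<in> UNIV \<Longrightarrow> (\<lambda>n. F (\<rho> n) x) \<longlonglongrightarrow> f x"
    "\<And>X. compact X \<Longrightarrow> X \<subseteq> UNIV \<Longrightarrow> uniform_limit X (F \<circ> \<rho>) f sequentially"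
    by (rule Montel[of UNIV "range F" F]) (use F loc_bound in auto)
  have "cmod (f x) \<le> A * T * exp (C * P x)" for x
    using F by (intro Lim_bounded[OF tendsto_norm[OF f(3)]]) auto
  moreover have "(deriv ^^ l) f (z j) = fact l * w j l" if l: "l < m j" for j l
  proof (rule LIMSEQ_unique)
    have "uniform_limit (ball (z j) 1) (F \<circ> \<rho>) f sequentially"
      by (rule uniform_limit_on_subset[OF f(4)[of "cball (z j) 1"]]) auto
    then show "(\<lambda>n. (deriv ^^ l) ((F \<circ> \<rho>) n) (z j)) \<longlonglongrightarrow> (deriv ^^ l) f (z j)"
      using F by (intro higher_deriv_complex_uniform_limit[where A = "ball (z j) 1"] always_eventually allI)
        (auto simp: o_def intro: holomorphic_on_subset)
    have "\<forall>\<^sub>F n in sequentially. (deriv ^^ l) ((F \<circ> \<rho>) n) (z j) = fact l * w j l"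
    proof (rule eventually_sequentiallyI[of "Suc j"])
      fix n assume "Suc j \<le> n"
      then have "j < \<rho> n" using seq_suble[OF f(2), of n] by simp
      then show "(deriv ^^ l) ((F \<circ> \<rho>) n) (z j) = fact l * w j l" using F l by simp
    qed
    then show "(\<lambda>n. (deriv ^^ l) ((F \<circ> \<rho>) n) (z j)) \<longlonglongrightarrow> fact l * w j l"
      by (rule tendsto_eventually)
  qed
  ultimately show ?thesis using that f(1) C(1) by blast
qed

end

section \<open>From the integral conditions to weighted counts\<close>

text \<open>
  Both counting integrals are of this form, with \<open>\<phi> t = 1\<close> and \<open>\<phi> t = 1 / t\<close>.
\<close>

lemma has_integral_sum_of_tails:
  fixes d :: "'a \<Rightarrow> real" and \<phi> :: "real \<Rightarrow> real"
  assumes "finite A" "\<And>k. k \<in> A \<Longrightarrow> 0 \<le> d k" "\<And>k. k \<in> A \<Longrightarrow> d k \<le> r"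
    "\<And>k. k \<in> A \<Longrightarrow> (\<phi> has_integral I k) {d k..r}"
  shows "((\<lambda>t. \<Sum>k\<in>A. if d k \<le> t then c k * \<phi> t else 0) has_integral (\<Sum>k\<in>A. c k * I k)) {0..r}"
proof (rule has_integral_sum[OF assms(1)])
  fix k assume k: "k \<in> A"
  have "((\<lambda>t. c k * \<phi> t) has_integral c k * I k) {d k..r}"
    using assms(4)[OF k] by (rule has_integral_mult_right)
  then have "((\<lambda>t. if t \<in> {d k..r} then c k * \<phi> t else 0) has_integral c k * I k) {0..r}"
    using assms(2,3)[OF k] by (subst has_integral_restrict) auto
  then show "((\<lambda>t. if d k \<le> t then c k * \<phi> t else 0) has_integral c k * I k) {0..r}"
    by (rule has_integral_eq[rotated]) auto
qed

lemma integral_n_count: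
  assumes fin: "finite {k. cmod (a - z k) \<le> r}"
  shows "integral {0..r} (\<lambda>t. real (n_count z m a t)) = (\<Sum>k | cmod (a - z k) \<le> r. m k * (r - cmod (a - z k)))"
proof (rule integral_unique)
  let ?A = "{k. cmod (a - z k) \<le> r}"
  have "((\<lambda>t. \<Sum>k\<in>?A. if cmod (a - z k) \<le> t then real (m k) * 1 else 0) has_integral
      (\<Sum>k\<in>?A. real (m k) * (r - cmod (a - z k)))) {0..r}"
  proof (intro has_integral_sum_of_tails fin)
    fix k assume "k \<in> ?A"
    then show "((\<lambda>t. 1) has_integral r - cmod (a - z k)) {cmod (a - z k)..r}"
      using has_integral_const_real[of "1::real" "cmod (a - z k)" r] by simp
  qed auto
  then show "((\<lambda>t. real (n_count z m a t)) has_integral (\<Sum>k\<in>?A. real (m k) * (r - cmod (a - z k)))) {0..r}"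
  proof (rule has_integral_eq[rotated])
    fix t assume t: "t \<in> {0..r}"
    have "{k\<in>?A. cmod (a - z k) \<le> t} = {k. cmod (a - z k) \<le> t}" using t by auto
    then show "(\<Sum>k\<in>?A. if cmod (a - z k) \<le> t then real (m k) * 1 else 0) = real (n_count z m a t)"
      unfolding n_count_def by (simp add: sum.inter_filter[OF fin, symmetric])
  qed
qed

lemma N_count_eq_sum:
  assumes fin: "finite {k. cmod (a - z k) \<le> r}" and r: "0 < r"
  shows "N_count z m a r = (\<Sum>k | 0 < cmod (a - z k) \<and> cmod (a - z k) \<le> r. m k * ln (r / cmod (a - z k)))
     + real (n_count z m a 0) * ln r"
proof -
  let ?A = "{k. 0 < cmod (a - z k) \<and> cmod (a - z k) \<le> r}"
  have finA: "finite ?A" by (rule finite_subset[OF _ fin]) auto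
  have inv: "((\<lambda>t. 1 / t) has_integral ln (r / d)) {d..r}" if "0 < d" "d \<le> r" for d
  proof -
    have "((\<lambda>t. 1 / t) has_integral (ln r - ln d)) {d..r}"
      using that by (intro fundamental_theorem_of_calculus)
        (auto intro!: derivative_eq_intros simp flip: has_real_derivative_iff_has_vector_derivative)
    then show ?thesis using that by (simp add: ln_div)
  qed
  have "((\<lambda>t. \<Sum>k\<in>?A. if cmod (a - z k) \<le> t then real (m k) * (1 / t) else 0) has_integral
      (\<Sum>k\<in>?A. real (m k) * ln (r / cmod (a - z k)))) {0..r}"
    by (intro has_integral_sum_of_tails finA inv) auto
  then have "((\<lambda>t. (real (n_count z m a t) - real (n_count z m a 0)) / t) has_integral
      (\<Sum>k\<in>?A. real (m k) * ln (r / cmod (a - z k)))) {0..r}"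
  proof (rule has_integral_eq[rotated])
    fix t assume t: "t \<in> {0..r}"
    have *: "{k\<in>?A. cmod (a - z k) \<le> t} = {k. cmod (a - z k) \<le> t} - {k. cmod (a - z k) \<le> 0}" using t by auto
    have "(\<Sum>k\<in>?A. if cmod (a - z k) \<le> t then real (m k) * (1 / t) else 0)
        = (\<Sum>k\<in>{k. cmod (a - z k) \<le> t} - {k. cmod (a - z k) \<le> 0}. real (m k) * (1 / t))"
      unfolding *[symmetric] by (rule sum.inter_filter[OF finA, symmetric])
    also have "\<dots> = (\<Sum>k\<in>{k. cmod (a - z k) \<le> t} - {k. cmod (a - z k) \<le> 0}. real (m k)) / t"
      by (simp add: sum_divide_distrib)
    also have "(\<Sum>k\<in>{k. cmod (a - z k) \<le> t} - {k. cmod (a - z k) \<le> 0}. real (m k))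
        = real (n_count z m a t) - real (n_count z m a 0)"
      unfolding n_count_def of_nat_sum using t
      by (intro sum_diff finite_subset[OF _ fin]) auto
    finally show "(\<Sum>k\<in>?A. if cmod (a - z k) \<le> t then real (m k) * (1 / t) else 0)
        = (real (n_count z m a t) - real (n_count z m a 0)) / t" .
  qed
  then show ?thesis unfolding N_count_def by (simp add: integral_unique)
qed

lemma multiplicity_variety_finite_disc:
  assumes "multiplicity_variety z m"
  shows "finite {k. cmod (z k) \<le> s}"
proof -
  have "\<forall>\<^sub>F k in sequentially. s < cmod (z k)"
    using assms by (auto simp: multiplicity_variety_def filterlim_at_top_dense)
  then obtain n where "\<And>k. n \<le> k \<Longrightarrow> s < cmod (z k)" by (auto simp: eventually_sequentially)
  then have "{k. cmod (z k) \<le> s} \<subseteq> {..<n}" by (force simp: not_le)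
  then show ?thesis by (rule finite_subset) auto
qed

lemma weight_log_bound:
  assumes "weight p"
  obtains L where "\<And>x. 1 + (cmod x)\<^sup>2 \<le> exp (L * (p x + 1))"
proof -
  have "(\<lambda>z. ln (1 + (cmod z)\<^sup>2)) \<in> O[at_infinity](p)" and p0: "\<And>z. 0 \<le> p z"
    using assms by (auto simp: weight_def)
  from landau_o.bigE[OF this(1)] obtain c where c: "c > 0"
    "\<forall>\<^sub>F z in at_infinity. norm (ln (1 + (cmod z)\<^sup>2)) \<le> c * norm (p z)" by blast
  then obtain b where b: "\<And>x. b \<le> cmod x \<Longrightarrow> norm (ln (1 + (cmod x)\<^sup>2)) \<le> c * norm (p x)"
    by (auto simp: eventually_at_infinity)
  define L where "L = c + ln (1 + b\<^sup>2)"
  have l: "0 \<le> ln (1 + b\<^sup>2)" by simp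
  have "1 + (cmod x)\<^sup>2 \<le> exp (L * (p x + 1))" for x
  proof -
    have pos: "0 < 1 + (cmod x)\<^sup>2" by (simp add: add_pos_nonneg)
    have nn: "0 \<le> c * p x" "0 \<le> ln (1 + b\<^sup>2) * p x" using c(1) l p0[of x] by auto
    have eq: "L * (p x + 1) = c * p x + c + ln (1 + b\<^sup>2) * p x + ln (1 + b\<^sup>2)"
      by (simp add: L_def algebra_simps)
    have "ln (1 + (cmod x)\<^sup>2) \<le> L * (p x + 1)"
    proof (cases "b \<le> cmod x")
      case True
      have "ln (1 + (cmod x)\<^sup>2) \<le> c * p x" using b[OF True] p0[of x] by simp
      then show ?thesis unfolding eq using nn l c(1) by linarith
    next
      case False
      then have "(cmod x)\<^sup>2 \<le> b\<^sup>2" by (intro power_mono) auto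
      then have "ln (1 + (cmod x)\<^sup>2) \<le> ln (1 + b\<^sup>2)" using pos by (subst ln_le_cancel_iff) auto
      then show ?thesis unfolding eq using nn l c(1) by linarith
    qed
    then have "exp (ln (1 + (cmod x)\<^sup>2)) \<le> exp (L * (p x + 1))" by (simp only: exp_le_cancel_iff)
    then show ?thesis using pos by (simp only: exp_ln)
  qed
  then show ?thesis by (rule that)
qed

lemma radial_weight_step:
  assumes "weight p" "radial p"
  obtains K where "\<And>x y. cmod y \<le> cmod x + 1 \<Longrightarrow> p y + 1 \<le> K * (p x + 1)"
proof -
  have sub: "subharmonic p" and p0: "\<And>z. 0 \<le> p z"
    and "\<exists>C1>0. \<exists>C2>0. \<forall>z w. cmod (z - w) \<le> 1 \<longrightarrow> p w \<le> C1 * p z + C2"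
    using assms(1) by (auto simp: weight_def)
  then obtain C1 C2 where C: "C1 > 0" "C2 > 0" "\<And>z w. cmod (z - w) \<le> 1 \<Longrightarrow> p w \<le> C1 * p z + C2" by blast
  have rad: "p x = p (of_real (cmod x))" for x using assms(2) unfolding radial_def by blast
  have "p y + 1 \<le> (C1 + C2 + 1) * (p x + 1)" if y: "cmod y \<le> cmod x + 1" for x y
  proof -
    have nn: "0 \<le> C1 * p x" "0 \<le> C2 * p x" using C p0[of x] by auto
    have eq: "(C1 + C2 + 1) * (p x + 1) = C1 * p x + C2 * p x + p x + C1 + C2 + 1" by (simp add: algebra_simps)
    show ?thesis
    proof (cases "cmod y \<le> cmod x")
      case True
      then have "p y \<le> p x" by (rule subharmonic_radial_mono[OF sub assms(2)])
      then show ?thesis unfolding eq using nn C(1,2) by linarith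
    next
      case False
      have "cmod (of_real (cmod x) - of_real (cmod y)) \<le> 1"
        using y False unfolding of_real_diff[symmetric] norm_of_real by linarith
      from C(3)[OF this] have "p y \<le> C1 * p x + C2" using rad[of x] rad[of y] by simp
      then show ?thesis unfolding eq using nn C(1,2) p0[of x] by linarith
    qed
  qed
  then show ?thesis by (rule that)
qed

lemma sparse_points_of_integral_conditions:
  assumes p: "weight p" "radial p" and V: "multiplicity_variety z m"
    and N: "\<exists>A>0. \<exists>B>0. \<forall>j. N_count z m (z j) (exp 1) \<le> A * p (z j) + B"
    and n: "\<exists>A'>0. \<exists>B'>0. \<forall>r>0.
           integral {0..r} (\<lambda>t. real (n_count z m 0 t)) \<le> A' * p (of_real r) + B'"
  obtains K L Q where "sparse_points (\<lambda>x. p x + 1) z m K L Q"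
proof -
  have sub: "subharmonic p" and p0: "\<And>z. 0 \<le> p z" using p(1) by (auto simp: weight_def)
  have rad: "p x = p (of_real (cmod x))" for x using p(2) unfolding radial_def by blast
  obtain K where K: "\<And>x y. cmod y \<le> cmod x + 1 \<Longrightarrow> p y + 1 \<le> K * (p x + 1)"
    using radial_weight_step[OF p] by blast
  obtain L where L: "\<And>x. 1 + (cmod x)\<^sup>2 \<le> exp (L * (p x + 1))"
    using weight_log_bound[OF p(1)] by blast
  obtain A B where AB: "A > 0" "B > 0" "\<And>j. N_count z m (z j) (exp 1) \<le> A * p (z j) + B" using N by blast
  obtain A' B' where AB': "A' > 0" "B' > 0"
    "\<And>r. r > 0 \<Longrightarrow> integral {0..r} (\<lambda>t. real (n_count z m 0 t)) \<le> A' * p (of_real r) + B'" using n by blast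
  define Q where "Q = A + B + A' + B'"
  have QP: "A * p x + B \<le> Q * (p x + 1)" "A' * p x + B' \<le> Q * (p x + 1)" for x
  proof -
    have "0 \<le> A * p x" "0 \<le> B * p x" "0 \<le> A' * p x" "0 \<le> B' * p x" using AB AB' p0[of x] by auto
    moreover have "Q * (p x + 1) = A * p x + B * p x + A' * p x + B' * p x + A + B + A' + B'"
      by (simp add: Q_def algebra_simps)
    ultimately show "A * p x + B \<le> Q * (p x + 1)" "A' * p x + B' \<le> Q * (p x + 1)"
      using AB(1,2) AB'(1,2) by linarith+
  qed
  have fin: "finite {k. cmod (z k) \<le> s}" for s by (rule multiplicity_variety_finite_disc[OF V])
  have fin': "finite {k. cmod (a - z k) \<le> s}" for a s
  proof (rule finite_subset[OF _ fin[of "s + cmod a"]], rule subsetI)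
    fix k assume "k \<in> {k. cmod (a - z k) \<le> s}"
    then show "k \<in> {k. cmod (z k) \<le> s + cmod a}"
      using norm_triangle_ineq2[of "z k" a] by (simp add: norm_minus_commute)
  qed
  have inj: "inj z" and mpos: "\<And>j. m j > 0" using V by (auto simp: multiplicity_variety_def)
  have "sparse_points (\<lambda>x. p x + 1) z m K L Q"
  proof
    fix x
    show "1 \<le> p x + 1" using p0 by simp
    show "1 + (cmod x)\<^sup>2 \<le> exp (L * (p x + 1))" by (rule L)
    show "(\<Sum>k | cmod (z k) \<le> cmod x. real (m k) * (cmod x - cmod (z k))) \<le> Q * (p x + 1)"
    proof (cases "x = 0")
      case True
      then show ?thesis using QP(1)[of x] AB(1,2) p0[of x]
        by (simp add: sum.neutral order_trans[OF _ QP(1)[of 0]])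
    next
      case False
      have "(\<Sum>k | cmod (z k) \<le> cmod x. real (m k) * (cmod x - cmod (z k)))
          = integral {0..cmod x} (\<lambda>t. real (n_count z m 0 t))"
        using integral_n_count[OF fin'[of 0 "cmod x"], of m] by simp
      also have "\<dots> \<le> A' * p (of_real (cmod x)) + B'" using False by (intro AB'(3)) auto
      also have "\<dots> \<le> Q * (p x + 1)" using QP(2)[of x] rad[of x] by simp
      finally show ?thesis .
    qed
  next
    fix x y assume "cmod x \<le> cmod y"
    then show "p x + 1 \<le> p y + 1" using subharmonic_radial_mono[OF sub p(2)] by simp
  next
    fix x y assume "cmod y \<le> cmod x + 1"
    then show "p y + 1 \<le> K * (p x + 1)" by (rule K)
  next
    fix a :: complex assume "1 \<le> cmod a"
    then have "a \<noteq> 0" by auto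
    from subharmonic_radial_supporting_slope[OF sub p(2) this] obtain \<beta>
      where "\<beta> \<ge> 0" "\<And>x. x \<noteq> 0 \<Longrightarrow> p a + \<beta> * ln (cmod x / cmod a) \<le> p x" by blast
    then show "\<exists>\<beta>\<ge>0. \<forall>x. x \<noteq> 0 \<longrightarrow> p a + 1 + \<beta> * ln (cmod x / cmod a) \<le> p x + 1" by force
  next
    fix j
    let ?S = "{k. k \<noteq> j \<and> cmod (z j - z k) < 1}"
    let ?A = "{k. 0 < cmod (z j - z k) \<and> cmod (z j - z k) \<le> exp 1}"
    have e1: "d \<le> exp 1" if "d < 1" for d :: real
      using that one_le_exp_iff[of 1] by linarith
    have finA: "finite ?A" by (rule finite_subset[OF _ fin'[of "z j" "exp 1"]]) auto
    have sub: "?S \<subseteq> ?A"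
    proof
      fix k assume "k \<in> ?S"
      moreover from this have "z j \<noteq> z k" using inj by (auto dest: injD)
      ultimately show "k \<in> ?A" using e1 by (simp only: mem_Collect_eq) simp
    qed
    have "(\<Sum>k\<in>?S. m k * ln (1 / cmod (z j - z k))) \<le> (\<Sum>k\<in>?S. m k * ln (exp 1 / cmod (z j - z k)))"
    proof (intro sum_mono mult_left_mono)
      fix k assume "k \<in> ?S"
      then have "0 < cmod (z j - z k)" using sub by blast
      then show "ln (1 / cmod (z j - z k)) \<le> ln (exp 1 / cmod (z j - z k))" by (simp add: ln_div)
    qed auto
    also have "\<dots> \<le> (\<Sum>k\<in>?A. m k * ln (exp 1 / cmod (z j - z k)))"
      by (intro sum_mono2 finA sub mult_nonneg_nonneg ln_ge_zero) auto
    also have "\<dots> \<le> N_count z m (z j) (exp 1)"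
      using N_count_eq_sum[OF fin'[of "z j" "exp 1"], of m] by simp
    also have "\<dots> \<le> A * p (z j) + B" by (rule AB(3))
    also have "\<dots> \<le> Q * (p (z j) + 1)" by (rule QP(1))
    finally show "(\<Sum>k\<in>?S. real (m k) * ln (1 / cmod (z j - z k))) \<le> Q * (p (z j) + 1)" .
  qed (use fin inj mpos in auto)
  then show ?thesis by (rule that)
qed

theorem theorem1p8:
  fixes p :: "complex \<Rightarrow> real" and z :: "nat \<Rightarrow> complex" and m :: "nat \<Rightarrow> nat"
  assumes "weight p" and "radial p"
    and "multiplicity_variety z m"
    and "\<exists>A>0. \<exists>B>0. \<forall>j. N_count z m (z j) (exp 1) \<le> A * p (z j) + B"
    and "\<exists>A'>0. \<exists>B'>0. \<forall>r>0.
           integral {0..r} (\<lambda>t. real (n_count z m 0 t)) \<le> A' * p (of_real r) + B'"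
  shows "interpolating_variety p z m"
  unfolding interpolating_variety_def
proof (intro allI impI)
  fix w :: "nat \<Rightarrow> nat \<Rightarrow> complex"
  assume "\<exists>A>0. \<exists>B>0. \<forall>j. (\<Sum>l<m j. cmod (w j l)) \<le> A * exp (B * p (z j))"
  then obtain A B where AB: "A > 0" "B > 0" "\<And>j. (\<Sum>l<m j. cmod (w j l)) \<le> A * exp (B * p (z j))" by blast
  obtain K L Q where "sparse_points (\<lambda>x. p x + 1) z m K L Q"
    using sparse_points_of_integral_conditions[OF assms] by blast
  then interpret sparse_points "\<lambda>x. p x + 1" z m K L Q .
  have w: "(\<Sum>l<m j. cmod (w j l)) \<le> A * exp (B * (p (z j) + 1))" for j
    using AB(1,2) by (intro order_trans[OF AB(3)] mult_left_mono) auto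
  obtain f C M where f: "f holomorphic_on UNIV" "0 \<le> C" "\<And>x. cmod (f x) \<le> M * exp (C * (p x + 1))"
    "\<And>j l. l < m j \<Longrightarrow> (deriv ^^ l) f (z j) = fact l * w j l"
    using interpolation[OF AB(1) w] by blast
  have "cmod (f x) \<le> (\<bar>M\<bar> + 1) * exp C * exp ((C + 1) * p x)" for x
  proof -
    have "p x \<ge> 0" using assms(1) by (simp add: weight_def)
    have "cmod (f x) \<le> M * exp (C * (p x + 1))" by (rule f(3))
    also have "\<dots> \<le> (\<bar>M\<bar> + 1) * exp (C + (C + 1) * p x)"
      using \<open>p x \<ge> 0\<close> by (intro mult_mono) (auto simp: algebra_simps)
    finally show ?thesis by (simp add: exp_add mult.assoc)
  qed
  then have "f \<in> A_space p" unfolding A_space_def using f(1,2)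
    by (intro CollectI conjI exI[of _ "(\<bar>M\<bar> + 1) * exp C"] exI[of _ "C + 1"]) (auto intro!: mult_pos_pos)
  moreover have "\<forall>j. \<forall>l<m j. (deriv ^^ l) f (z j) / fact l = w j l" using f(4) by simp
  ultimately show "\<exists>f\<in>A_space p. \<forall>j. \<forall>l<m j. (deriv ^^ l) f (z j) / fact l = w j l" by blast
qed

end
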